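(* Let $E$ be a field, let $\bar E$ be an algebraic closure of $E$, let $E\le K\le\bar E$ be an intermediate subfield, and let $F/E$ be an algebraic extension. Suppose that there exists a prime $p$ not dividing $[F:E]_s$ such that $\mathrm{Aut}(\bar E/K)$ is a pro-$p$ group. Then $$[E^F_{\mathrm t,K}:E]_s\le\liminf_{F_0\in I_{F/E}}|\mathrm{Hom}_E(F_0,K^{\mathrm{ins}})|.$$
   Context: For an algebraic extension $M/E$: $[M:E]_s=\#\mathrm{Hom}_E(M,\bar E)$, where $\#A$ is the cardinality of $A$ if finite and $\infty$ otherwise. A prime $p$ divides $[F:E]_s$ if there is a finite subextension $E\le F_0\le F$ with $p\mid[F_0:E]_s$. An algebraic extension $M/E$ is totally-$K$ if every $\tau\in\mathrm{Hom}_E(M,\bar E)$ has image contained in $K$. There is a unique maximal totally-$K$ extension $E_{\mathrm t,K}$ of $E$ inside $\bar E$, and for an algebraic extension $F/E$, $E^F_{\mathrm t,K}$ denotes the unique maximal totally-$K$ subextension of $F/E$ ($=E_{\mathrm t,K}\cap F$ when $F\le\bar E$). $K^{\mathrm{ins}}$ is the maximal purely inseparable algebraic extension of $K$ (inside $\bar E$). $\mathrm{Aut}(\bar E/K)$ carries its usual profinite topology. $I_{F/E}$ is the set of all finite subextensions $E\le F_0\le F$, a directed poset under inclusion. For a directed poset $I$, a subset $J\subseteq I$ is cofinal if each $\omega\in I$ has some $\pi\in J$ with $\pi\ge\omega$. For $f:I\to[0,\infty)$, a point $P\in[0,\infty]$ (one-point compactification of $[0,\infty)$) is a limit point of $f$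 if $f^{-1}(V)$ is cofinal for every neighborhood $V$ of $P$; $\liminf_I f$ is the infimum of the (nonempty) set of limit points of $f$. *)

theory Defs
  imports "HOL-Analysis.Analysis" "HOL-Algebra.Algebra" "HOL-Algebra.Algebraic_Closure"
begin

text \<open>The algebraic closure is a record \<open>L\<close> containing the base field as a subset \<open>E\<close>, with
  \<open>algebraic_closure L E\<close>. A field extension of \<open>E\<close> which need not lie inside \<open>L\<close> is a record \<open>M\<close>
  together with a ring homomorphism \<open>\<iota>\<close> from \<open>E\<close> to \<open>M\<close>; its subextensions are the subfields of
  \<open>M\<close> that contain \<open>\<iota> ` E\<close>.\<close>

definition ecard :: "'a set \<Rightarrow> enat" where
  "ecard A = (if finite A then enat (card A) else \<infinity>)"

subsection \<open>Homomorphisms over the base field\<close>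

text \<open>Homomorphisms are taken extensional on the carrier of \<open>M\<close>, so that two of them are equal iff
  they agree on \<open>M\<close> and cardinalities count correctly.\<close>

definition ext_homs ::
  "'a set \<Rightarrow> ('a \<Rightarrow> 'b) \<Rightarrow> ('b, 'm) ring_scheme \<Rightarrow> ('a, 'n) ring_scheme \<Rightarrow> ('b \<Rightarrow> 'a) set" where
  "ext_homs E \<iota> M N =
    {\<phi> \<in> ring_hom M N. \<phi> \<in> extensional (carrier M) \<and> (\<forall>e\<in>E. \<phi> (\<iota> e) = e)}"

definition sep_degree ::
  "('a, 'n) ring_scheme \<Rightarrow> 'a set \<Rightarrow> ('a \<Rightarrow> 'b) \<Rightarrow> ('b, 'm) ring_scheme \<Rightarrow> enat" where
  "sep_degree L E \<iota> M = ecard (ext_homs E \<iota> M L)"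

definition subexts :: "('b, 'm) ring_scheme \<Rightarrow> 'b set \<Rightarrow> 'b set set" where
  "subexts F k = {M. subfield M F \<and> k \<subseteq> M}"

definition fin_subexts :: "('b, 'm) ring_scheme \<Rightarrow> 'b set \<Rightarrow> 'b set set" where
  "fin_subexts F k = {M \<in> subexts F k. ring.finite_dimension F k M}"

definition dvd_sep_degree ::
  "nat \<Rightarrow> ('a, 'n) ring_scheme \<Rightarrow> 'a set \<Rightarrow> ('a \<Rightarrow> 'b) \<Rightarrow> ('b, 'm) ring_scheme \<Rightarrow> bool" where
  "dvd_sep_degree p L E \<iota> F \<longleftrightarrow>
    (\<exists>M \<in> fin_subexts F (\<iota> ` E). \<exists>d. sep_degree L E \<iota> (F\<lparr>carrier := M\<rparr>) = enat d \<and> p dvd d)"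

subsection \<open>Totally-\<open>K\<close> extensions\<close>

definition totally ::
  "('a, 'n) ring_scheme \<Rightarrow> 'a set \<Rightarrow> 'a set \<Rightarrow> ('a \<Rightarrow> 'b) \<Rightarrow> ('b, 'm) ring_scheme \<Rightarrow> bool" where
  "totally L E K \<iota> M \<longleftrightarrow> (\<forall>\<tau> \<in> ext_homs E \<iota> M L. \<tau> ` carrier M \<subseteq> K)"

text \<open>The greatest totally-\<open>K\<close> subextension exists because the compositum of totally-\<open>K\<close>
  subextensions is again totally-\<open>K\<close>.\<close>

definition max_totally ::
  "('a, 'n) ring_scheme \<Rightarrow> 'a set \<Rightarrow> 'a set \<Rightarrow> ('a \<Rightarrow> 'b) \<Rightarrow> ('b, 'm) ring_scheme \<Rightarrow> 'b set" where
  "max_totally L E K \<iota> F =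
    (GREATEST M. M \<in> subexts F (\<iota> ` E) \<and> totally L E K \<iota> (F\<lparr>carrier := M\<rparr>))"

subsection \<open>Purely inseparable extensions\<close>

definition char_exponent :: "('a, 'n) ring_scheme \<Rightarrow> nat" where
  "char_exponent R =
    (if \<exists>n::nat. 0 < n \<and> [n] \<cdot>\<^bsub>R\<^esub> \<one>\<^bsub>R\<^esub> = \<zero>\<^bsub>R\<^esub>
     then LEAST n::nat. 0 < n \<and> [n] \<cdot>\<^bsub>R\<^esub> \<one>\<^bsub>R\<^esub> = \<zero>\<^bsub>R\<^esub> else 1)"

definition purely_inseparable :: "('a, 'n) ring_scheme \<Rightarrow> 'a set \<Rightarrow> 'a set \<Rightarrow> bool" where
  "purely_inseparable L K M \<longleftrightarrow>
    M \<in> subexts L K \<and> (\<forall>x\<in>M. \<exists>n::nat. x [^]\<^bsub>L\<^esub> (char_exponent L ^ n) \<in> K)"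

definition ins_closure :: "('a, 'n) ring_scheme \<Rightarrow> 'a set \<Rightarrow> 'a set" where
  "ins_closure L K = (GREATEST M. purely_inseparable L K M)"

subsection \<open>Automorphism groups, the Krull topology and pro-\<open>p\<close> groups\<close>

definition aut_group :: "('a, 'n) ring_scheme \<Rightarrow> 'a set \<Rightarrow> ('a \<Rightarrow> 'a) monoid" where
  "aut_group L K = BijGroup (carrier L)
    \<lparr>carrier := {\<sigma> \<in> ring_hom L L. \<sigma> \<in> Bij (carrier L) \<and> (\<forall>x\<in>K. \<sigma> x = x)}\<rparr>"

definition krull_topology :: "('a, 'n) ring_scheme \<Rightarrow> 'a set \<Rightarrow> ('a \<Rightarrow> 'a) topology" where
  "krull_topology L K = topology_generated_by
    {\<sigma> <#\<^bsub>aut_group L K\<^esub> carrier (aut_group L M) | \<sigma> M.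
      \<sigma> \<in> carrier (aut_group L K) \<and> M \<in> fin_subexts L K}"

definition topological_group :: "('g, 'k) monoid_scheme \<Rightarrow> 'g topology \<Rightarrow> bool" where
  "topological_group G T \<longleftrightarrow> group G \<and> topspace T = carrier G \<and>
    continuous_map (prod_topology T T) T (\<lambda>(x, y). x \<otimes>\<^bsub>G\<^esub> y) \<and>
    continuous_map T T (\<lambda>x. inv\<^bsub>G\<^esub> x)"

definition profinite_group :: "('g, 'k) monoid_scheme \<Rightarrow> 'g topology \<Rightarrow> bool" where
  "profinite_group G T \<longleftrightarrow> topological_group G T \<and> compact_space T \<and> Hausdorff_space T \<and>
    (\<forall>C. connectedin T C \<longrightarrow> (\<exists>x. C \<subseteq> {x}))"

definition pro_p_group :: "nat \<Rightarrow> ('g, 'k) monoid_scheme \<Rightarrow> 'g topology \<Rightarrow> bool" where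
  "pro_p_group p G T \<longleftrightarrow> profinite_group G T \<and>
    (\<forall>N. N \<lhd> G \<and> openin T N \<longrightarrow> (\<exists>n::nat. card (rcosets\<^bsub>G\<^esub> N) = p ^ n))"

subsection \<open>Limit inferior over a directed poset\<close>

definition cofinal :: "'i::order set \<Rightarrow> 'i set \<Rightarrow> bool" where
  "cofinal I J \<longleftrightarrow> J \<subseteq> I \<and> (\<forall>\<omega>\<in>I. \<exists>\<pi>\<in>J. \<omega> \<le> \<pi>)"

text \<open>The type \<^typ>\<open>ennreal\<close> with its order topology is the one-point compactification of the
  half-line of nonnegative reals.\<close>

definition limit_points :: "'i::order set \<Rightarrow> ('i \<Rightarrow> ennreal) \<Rightarrow> ennreal set" where
  "limit_points I f = {P. \<forall>V. open V \<and> P \<in> V \<longrightarrow> cofinal I {i \<in> I. f i \<in> V}}"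

definition dir_liminf :: "'i::order set \<Rightarrow> ('i \<Rightarrow> ennreal) \<Rightarrow> ennreal" where
  "dir_liminf I f = Inf (limit_points I f)"

end

theory Submission
  imports Defs
begin

text \<open>Let \<open>M = E\<^sup>F\<^sub>t\<^sub>,\<^sub>K\<close>, let \<open>M\<^sub>0 \<subseteq> M\<close> and \<open>N \<supseteq> M\<^sub>0\<close> be finite subextensions of \<open>F\<close>. Since \<open>Aut(L/E)\<close> acts
  transitively on \<open>Hom\<^sub>E(M\<^sub>0, L)\<close>, all fibres of the restriction \<open>Hom\<^sub>E(N, L) \<rightarrow> Hom\<^sub>E(M\<^sub>0, L)\<close> have the
  same cardinality, which divides \<open>[N:E]\<^sub>s\<close> and is therefore prime to \<open>p\<close>. All homomorphisms from \<open>M\<^sub>0\<close>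
  have image in \<open>K\<close>, so the pro-\<open>p\<close> group \<open>Aut(L/K)\<close> preserves every fibre; its orbits have \<open>p\<close>-power
  length, so it has a fixed point in every fibre. Fixed points are homomorphisms into the fixed
  field of \<open>Aut(L/K)\<close>, which is \<open>K\<^sup>i\<^sup>n\<^sup>s\<close>. Hence \<open>|Hom\<^sub>E(N, K\<^sup>i\<^sup>n\<^sup>s)| \<ge> [M\<^sub>0:E]\<^sub>s\<close> for all \<open>N \<supseteq> M\<^sub>0\<close>, and
  \<open>[M:E]\<^sub>s\<close> is the supremum of the \<open>[M\<^sub>0:E]\<^sub>s\<close>.\<close>

subsection \<open>Extension of homomorphisms to algebraic extensions\<close>

text \<open>Both sides of each law are normalized coefficient lists, so it suffices to compare
  coefficients, where \<open>h\<close> passes through the convolution sum. Working over fields makes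
  \<open>h\<close> injective, so leading coefficients stay nonzero and \<open>map h\<close>
  preserves normalization.\<close>

lemma map_poly_ring_hom:
  assumes "field R" and "field S" and h: "h \<in> ring_hom R S"
  shows "map h \<in> ring_hom (poly_ring R) (poly_ring S)"
proof -
  interpret R: field R by fact
  interpret S: field S by fact
  interpret ring_hom_ring R S h
    using ring_hom_ringI2[OF R.ring_axioms S.ring_axioms h] .
  have coeff_map: "S.coeff (map h p) i = h (R.coeff p i)" for p i
    by (induction p) auto
  have closed: "map h p \<in> carrier (poly_ring S)" if "p \<in> carrier (poly_ring R)" for p
    using polynomial_hom[OF h assms(1,2) that] .
  have set_in: "set p \<subseteq> carrier R" if "p \<in> carrier (poly_ring R)" for p
    using that R.polynomial_incl univ_poly_carrier by blast
  have set_in': "set p \<subseteq> carrier S" if "p \<in> carrier (poly_ring S)" for p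
    using that S.polynomial_incl univ_poly_carrier by blast
  have eqI: "p = q" if "p \<in> carrier (poly_ring S)" "q \<in> carrier (poly_ring S)"
      "\<And>i. S.coeff p i = S.coeff q i" for p q
    using that S.coeff_iff_polynomial_cond[of "carrier S" p q] by (auto simp: univ_poly_carrier)
  interpret UR: ring "poly_ring R" by (rule R.univ_poly_is_ring[OF R.carrier_is_subring])
  interpret US: ring "poly_ring S" by (rule S.univ_poly_is_ring[OF S.carrier_is_subring])
  show ?thesis
  proof (rule ring_hom_memI)
    fix p assume "p \<in> carrier (poly_ring R)" thus "map h p \<in> carrier (poly_ring S)"
      by (rule closed)
  next
    fix p q assume p: "p \<in> carrier (poly_ring R)" and q: "q \<in> carrier (poly_ring R)"
    show "map h (p \<otimes>\<^bsub>poly_ring R\<^esub> q) = map h p \<otimes>\<^bsub>poly_ring S\<^esub> map h q"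
    proof (rule eqI)
      fix i
      have c: "R.coeff p k \<in> carrier R" "R.coeff q k \<in> carrier R" for k
        using R.coeff_in_carrier set_in p q by auto
      show "S.coeff (map h (p \<otimes>\<^bsub>poly_ring R\<^esub> q)) i = S.coeff (map h p \<otimes>\<^bsub>poly_ring S\<^esub> map h q) i"
        unfolding univ_poly_mult coeff_map R.poly_mult_coeff[OF set_in[OF p] set_in[OF q]]
          S.poly_mult_coeff[OF set_in'[OF closed[OF p]] set_in'[OF closed[OF q]]]
        using c by (subst hom_finsum) (auto intro!: S.add.finprod_cong')
    qed (use p q closed in auto)
    show "map h (p \<oplus>\<^bsub>poly_ring R\<^esub> q) = map h p \<oplus>\<^bsub>poly_ring S\<^esub> map h q"
    proof (rule eqI)
      fix i
      have c: "R.coeff p k \<in> carrier R" "R.coeff q k \<in> carrier R" for k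
        using R.coeff_in_carrier set_in p q by auto
      show "S.coeff (map h (p \<oplus>\<^bsub>poly_ring R\<^esub> q)) i = S.coeff (map h p \<oplus>\<^bsub>poly_ring S\<^esub> map h q) i"
        unfolding univ_poly_add coeff_map R.poly_add_coeff[OF set_in[OF p] set_in[OF q]]
          S.poly_add_coeff[OF set_in'[OF closed[OF p]] set_in'[OF closed[OF q]]]
        using c by simp
    qed (use p q closed in auto)
  next
    show "map h \<one>\<^bsub>poly_ring R\<^esub> = \<one>\<^bsub>poly_ring S\<^esub>"
      by (simp add: univ_poly_one)
  qed
qed

text \<open>Evaluation \<Phi> at \<open>x\<close> has kernel generated by the minimal polynomial of
  \<open>x\<close>. The map \<Psi>, which applies \<open>g\<close> to the coefficients and evaluates
  at \<open>y\<close>, kills that generator, hence factors through the image of \<Phi>, and this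
  image is the simple extension.\<close>

lemma simple_extension_hom:
  assumes "field F" and "field L" and M: "subfield M F"
    and g: "g \<in> ring_hom (F\<lparr>carrier := M\<rparr>) L"
    and x: "x \<in> carrier F" "ring.algebraic F M x"
    and y: "y \<in> carrier L" "ring.eval L (map g (ring.Irr F M x)) y = \<zero>\<^bsub>L\<^esub>"
  obtains h where "h \<in> ring_hom (F\<lparr>carrier := ring.simple_extension F M x\<rparr>) L"
    "\<And>a. a \<in> M \<Longrightarrow> h a = g a" "h x = y"
proof -
  interpret F: field F by fact
  interpret L: field L by fact
  have sM: "subring M F" using subfieldE(1)[OF M] .
  have FM: "field (F\<lparr>carrier := M\<rparr>)" using F.subfield_iff(2)[OF M] .
  interpret FM: field "F\<lparr>carrier := M\<rparr>" by fact
  interpret UM: domain "univ_poly F M" by (rule F.univ_poly_is_domain[OF sM])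
  interpret UL: domain "poly_ring L" by (rule L.univ_poly_is_domain[OF L.carrier_is_subring])
  have alg: "(F.algebraic over M) x" using x(2) by (simp add: over_def)
  define \<Phi> where "\<Phi> = (\<lambda>p. F.eval p x)"
  define \<Psi> where "\<Psi> = (\<lambda>p. L.eval (map g p) y)"
  have \<Phi>: "\<Phi> \<in> ring_hom (univ_poly F M) F"
    unfolding \<Phi>_def by (rule F.eval_is_hom[OF sM x(1)])
  have "map g \<in> ring_hom (poly_ring (F\<lparr>carrier := M\<rparr>)) (poly_ring L)"
    by (rule map_poly_ring_hom[OF FM assms(2) g])
  hence mg: "map g \<in> ring_hom (univ_poly F M) (poly_ring L)"
    using F.univ_poly_consistent[OF sM] by simp
  have \<Psi>: "\<Psi> \<in> ring_hom (univ_poly F M) L"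
    using ring_hom_trans[OF mg L.eval_is_hom[OF L.carrier_is_subring y(1)]]
    by (simp add: \<Psi>_def comp_def)
  interpret P: ring_hom_ring "univ_poly F M" F \<Phi>
    using ring_hom_ringI2[OF UM.ring_axioms F.ring_axioms \<Phi>] .
  interpret S: ring_hom_ring "univ_poly F M" L \<Psi>
    using ring_hom_ringI2[OF UM.ring_axioms L.ring_axioms \<Psi>] .
  have ker: "\<Psi> p = \<zero>\<^bsub>L\<^esub>" if p: "p \<in> carrier (univ_poly F M)" "\<Phi> p = \<zero>\<^bsub>F\<^esub>" for p
  proof -
    have "p \<in> a_kernel (univ_poly F M) F (\<lambda>p. F.eval p x)"
      using p by (auto simp: a_kernel_def' \<Phi>_def)
    hence "p \<in> PIdl\<^bsub>univ_poly F M\<^esub> (F.Irr M x)"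
      using F.Irr_generates_ker[OF M x(1) alg] by simp
    then obtain q where q: "q \<in> carrier (univ_poly F M)" "p = q \<otimes>\<^bsub>univ_poly F M\<^esub> F.Irr M x"
      by (auto simp: cgenideal_def)
    have "\<Psi> p = \<Psi> q \<otimes>\<^bsub>L\<^esub> \<Psi> (F.Irr M x)"
      using q F.IrrE(1)[OF M x(1) alg] by simp
    moreover have "\<Psi> (F.Irr M x) = \<zero>\<^bsub>L\<^esub>" using y(2) by (simp add: \<Psi>_def)
    ultimately show ?thesis using q(1) S.hom_closed by simp
  qed
  have eq: "\<Psi> p = \<Psi> q" if p: "p \<in> carrier (univ_poly F M)" and q: "q \<in> carrier (univ_poly F M)"
      and "\<Phi> p = \<Phi> q" for p q
  proof -
    have "\<Phi> (p \<ominus>\<^bsub>univ_poly F M\<^esub> q) = \<Phi> p \<ominus>\<^bsub>F\<^esub> \<Phi> q"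
      using p q by (simp add: a_minus_def)
    hence "\<Phi> (p \<ominus>\<^bsub>univ_poly F M\<^esub> q) = \<zero>\<^bsub>F\<^esub>" using that by simp
    hence "\<Psi> (p \<ominus>\<^bsub>univ_poly F M\<^esub> q) = \<zero>\<^bsub>L\<^esub>" using ker p q by simp
    hence "\<Psi> p \<ominus>\<^bsub>L\<^esub> \<Psi> q = \<zero>\<^bsub>L\<^esub>" using p q by (simp add: a_minus_def)
    thus ?thesis using p q by simp
  qed
  have se: "F.simple_extension M x = \<Phi> ` carrier (univ_poly F M)"
    unfolding \<Phi>_def by (rule F.simple_extension_as_eval_img[OF subfieldE(3)[OF M] x(1)])
  \<comment> \<open>The preimage polynomial is chosen arbitrarily; by \<open>eq\<close> the value of
    \<Psi> does not depend on the choice.\<close>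
  define h where "h = (\<lambda>z. \<Psi> (SOME p. p \<in> carrier (univ_poly F M) \<and> \<Phi> p = z))"
  have h: "h (\<Phi> p) = \<Psi> p" if "p \<in> carrier (univ_poly F M)" for p
  proof -
    have "\<exists>q. q \<in> carrier (univ_poly F M) \<and> \<Phi> q = \<Phi> p" using that by blast
    from someI_ex[OF this] show ?thesis unfolding h_def using eq that by blast
  qed
  show thesis
  proof (rule that[of h])
    show "h \<in> ring_hom (F\<lparr>carrier := F.simple_extension M x\<rparr>) L"
    proof (rule ring_hom_memI, simp_all)
      fix a assume "a \<in> F.simple_extension M x"
      thus "h a \<in> carrier L" using h unfolding se by auto
    next
      fix a b assume "a \<in> F.simple_extension M x" "b \<in> F.simple_extension M x"
      then obtain p q where pq: "p \<in> carrier (univ_poly F M)" "q \<in> carrier (univ_poly F M)"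
        "a = \<Phi> p" "b = \<Phi> q" unfolding se by blast
      show "h (a \<otimes>\<^bsub>F\<^esub> b) = h a \<otimes>\<^bsub>L\<^esub> h b"
        using pq h[of "p \<otimes>\<^bsub>univ_poly F M\<^esub> q"] h by simp
      show "h (a \<oplus>\<^bsub>F\<^esub> b) = h a \<oplus>\<^bsub>L\<^esub> h b"
        using pq h[of "p \<oplus>\<^bsub>univ_poly F M\<^esub> q"] h by simp
    next
      show "h \<one>\<^bsub>F\<^esub> = \<one>\<^bsub>L\<^esub>" using h[of "\<one>\<^bsub>univ_poly F M\<^esub>"] by simp
    qed
  next
    fix a assume a: "a \<in> M"
    have gz: "g \<zero>\<^bsub>F\<^esub> = \<zero>\<^bsub>L\<^esub>"
      using ring_hom_zero[OF g FM.ring_axioms L.ring_axioms] by simp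
    have ga: "g a \<in> carrier L" using ring_hom_memE(1)[OF g, of a] a by simp
    have aF: "a \<in> carrier F" using a subfieldE(3)[OF M] by blast
    \<comment> \<open>The constant polynomial with value \<open>a\<close> is \<open>[a]\<close> only
      for nonzero \<open>a\<close>; the zero polynomial is the empty list.\<close>
    show "h a = g a"
    proof (cases "a = \<zero>\<^bsub>F\<^esub>")
      case True
      have "[] \<in> carrier (univ_poly F M)" using univ_poly_zero_closed .
      from h[OF this] show ?thesis unfolding \<Phi>_def \<Psi>_def using True gz by simp
    next
      case False
      have "[a] \<in> carrier (univ_poly F M)"
        using False a by (simp add: polynomial_def univ_poly_carrier[symmetric])
      from h[OF this] show ?thesis unfolding \<Phi>_def \<Psi>_def using ga aF by simp
    qed
  next
    have "[\<one>\<^bsub>F\<^esub>, \<zero>\<^bsub>F\<^esub>] \<in> carrier (univ_poly F M)"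
      using F.var_closed(1)[OF sM] by (simp add: var_def)
    moreover have "g \<one>\<^bsub>F\<^esub> = \<one>\<^bsub>L\<^esub>" "g \<zero>\<^bsub>F\<^esub> = \<zero>\<^bsub>L\<^esub>"
      using ring_hom_one[OF g] ring_hom_zero[OF g FM.ring_axioms L.ring_axioms] by simp_all
    ultimately show "h x = y" using h[of "[\<one>\<^bsub>F\<^esub>, \<zero>\<^bsub>F\<^esub>]"] x y unfolding \<Phi>_def \<Psi>_def by simp
  qed
qed

lemma (in ring) a_inv_subring:
  assumes "subring M R" "x \<in> M"
  shows "\<ominus>\<^bsub>R\<lparr>carrier := M\<rparr>\<^esub> x = \<ominus> x"
proof -
  interpret M: ring "R\<lparr>carrier := M\<rparr>" by (rule subring_is_ring[OF assms(1)])
  show ?thesis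
    using M.minus_equality[of "\<ominus> x" x] subringE(1,5)[OF assms(1)] assms(2) l_neg[of x] by auto
qed

lemma (in algebraically_closed) exists_root_over_carrier:
  assumes "p \<in> carrier (poly_ring L)" and "degree p > 0"
  obtains y where "y \<in> carrier L" "eval p y = \<zero>"
proof -
  have "size (roots p) > 0" using roots_over_carrier[OF assms(1)] assms(2) by (simp add: splitted_def)
  then obtain y where "y \<in># roots p" by (metis multiset_nonemptyE size_empty less_irrefl)
  thus thesis using that roots_mem_iff_is_root[OF assms(1)] by (auto simp: is_root_def)
qed

text \<open>Zorn's lemma gives a maximal extension of \<open>g\<close> to a subfield
  \<open>N\<close>. For any \<open>x\<close> in \<open>F\<close>, the image in \<open>L\<close> of
  its minimal polynomial over \<open>N\<close> has a root, so the map extends to the field generated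
  by \<open>N\<close> and \<open>x\<close>; maximality then forces \<open>x\<close> into
  \<open>N\<close>.\<close>

theorem hom_extends_to_algebraic_extension:
  assumes "field F" and "algebraically_closed L" and M: "subfield M F"
    and alg: "\<And>x. x \<in> carrier F \<Longrightarrow> ring.algebraic F M x"
    and g: "g \<in> ring_hom (F\<lparr>carrier := M\<rparr>) L"
  obtains h where "h \<in> ring_hom F L" "\<And>a. a \<in> M \<Longrightarrow> h a = g a"
proof -
  interpret F: field F by fact
  interpret L: algebraically_closed L by fact
  have fL: "field L" by unfold_locales
  \<comment> \<open>Graphs of partial extensions, described by conditions on at most two pairs each, so that they
    pass to unions of chains.\<close>
  define \<A> where "\<A> = {G. (\<lambda>a. (a, g a)) ` M \<subseteq> G \<and> G \<subseteq> carrier F \<times> carrier L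
    \<and> (\<forall>a b c d. (a, b) \<in> G \<longrightarrow> (c, d) \<in> G \<longrightarrow>
          (a \<oplus>\<^bsub>F\<^esub> c, b \<oplus>\<^bsub>L\<^esub> d) \<in> G \<and> (a \<otimes>\<^bsub>F\<^esub> c, b \<otimes>\<^bsub>L\<^esub> d) \<in> G)
    \<and> (\<forall>a b. (a, b) \<in> G \<longrightarrow> (\<ominus>\<^bsub>F\<^esub> a, \<ominus>\<^bsub>L\<^esub> b) \<in> G)
    \<and> (\<forall>a b. (a, b) \<in> G \<longrightarrow> a \<noteq> \<zero>\<^bsub>F\<^esub> \<longrightarrow> (\<exists>c. (inv\<^bsub>F\<^esub> a, c) \<in> G))
    \<and> (\<forall>b. (\<zero>\<^bsub>F\<^esub>, b) \<in> G \<longrightarrow> b = \<zero>\<^bsub>L\<^esub>)}"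
  have from_hom: "(\<lambda>a. (a, h a)) ` N \<in> \<A>"
    if N: "subfield N F" and MN: "M \<subseteq> N" and h: "h \<in> ring_hom (F\<lparr>carrier := N\<rparr>) L"
      and hg: "\<And>a. a \<in> M \<Longrightarrow> h a = g a" for N h
  proof -
    have sN: "subring N F" using subfieldE(1)[OF N] .
    interpret FN: ring "F\<lparr>carrier := N\<rparr>" by (rule F.subring_is_ring[OF sN])
    interpret h: ring_hom_ring "F\<lparr>carrier := N\<rparr>" L h
      using ring_hom_ringI2[OF FN.ring_axioms L.ring_axioms h] .
    have neg: "h (\<ominus>\<^bsub>F\<^esub> a) = \<ominus>\<^bsub>L\<^esub> h a" if "a \<in> N" for a
      using h.hom_a_inv[of a] that F.a_inv_subring[OF sN that] by simp
    have inv: "inv\<^bsub>F\<^esub> a \<in> N" if "a \<in> N" "a \<noteq> \<zero>\<^bsub>F\<^esub>" for a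
      using F.subfield_m_inv(1)[OF N] that by auto
    show ?thesis unfolding \<A>_def
      using subringE[OF sN] MN hg neg inv h.hom_closed h.hom_add h.hom_mult h.hom_zero
      by (auto simp: image_iff)
  qed
  have to_hom: "\<exists>N h. subfield N F \<and> M \<subseteq> N \<and> h \<in> ring_hom (F\<lparr>carrier := N\<rparr>) L
      \<and> (\<forall>a\<in>M. h a = g a) \<and> G = (\<lambda>a. (a, h a)) ` N" if "G \<in> \<A>" for G
  proof -
    have base: "(a, g a) \<in> G" if "a \<in> M" for a using \<open>G \<in> \<A>\<close> that unfolding \<A>_def by blast
    have inF: "a \<in> carrier F" "b \<in> carrier L" if "(a, b) \<in> G" for a b
      using \<open>G \<in> \<A>\<close> that unfolding \<A>_def by blast+
    have add: "(a \<oplus>\<^bsub>F\<^esub> c, b \<oplus>\<^bsub>L\<^esub> d) \<in> G" and mult: "(a \<otimes>\<^bsub>F\<^esub> c, b \<otimes>\<^bsub>L\<^esub> d) \<in> G"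
      if "(a, b) \<in> G" "(c, d) \<in> G" for a b c d
      using \<open>G \<in> \<A>\<close> that unfolding \<A>_def by blast+
    have neg: "(\<ominus>\<^bsub>F\<^esub> a, \<ominus>\<^bsub>L\<^esub> b) \<in> G" if "(a, b) \<in> G" for a b
      using \<open>G \<in> \<A>\<close> that unfolding \<A>_def by blast
    have inv: "\<exists>c. (inv\<^bsub>F\<^esub> a, c) \<in> G" if "(a, b) \<in> G" "a \<noteq> \<zero>\<^bsub>F\<^esub>" for a b
      using \<open>G \<in> \<A>\<close> that unfolding \<A>_def by blast
    have zero: "b = \<zero>\<^bsub>L\<^esub>" if "(\<zero>\<^bsub>F\<^esub>, b) \<in> G" for b
      using \<open>G \<in> \<A>\<close> that unfolding \<A>_def by blast
    \<comment> \<open>Two values over the same point differ by a value over zero, which membership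
      in \<open>\<A>\<close> forces to vanish. This is why \<open>\<A>\<close> need not demand
      single-valuedness.\<close>
    have sv: "b = c" if "(a, b) \<in> G" "(a, c) \<in> G" for a b c
    proof -
      have "(a \<oplus>\<^bsub>F\<^esub> \<ominus>\<^bsub>F\<^esub> a, b \<oplus>\<^bsub>L\<^esub> \<ominus>\<^bsub>L\<^esub> c) \<in> G" using add neg that by blast
      hence "b \<oplus>\<^bsub>L\<^esub> \<ominus>\<^bsub>L\<^esub> c = \<zero>\<^bsub>L\<^esub>" using zero F.r_neg inF[OF that(1)] by simp
      thus ?thesis using inF[OF that(1)] inF[OF that(2)] L.minus_equality L.minus_minus
        by (metis L.a_inv_closed)
    qed
    define N where "N = fst ` G"
    define h where "h = (\<lambda>a. THE b. (a, b) \<in> G)"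
    have h: "h a = b" if "(a, b) \<in> G" for a b
      unfolding h_def using that sv by blast
    have hG: "(a, h a) \<in> G" if "a \<in> N" for a
      using that h unfolding N_def by fastforce
    have NI: "a \<in> N" if "(a, b) \<in> G" for a b
      using that unfolding N_def by force
    have MN: "M \<subseteq> N" using base NI by blast
    have "subfield N F"
    proof (rule F.subfieldI'[OF F.subringI])
      show "N \<subseteq> carrier F" using inF hG by blast
      show "\<one>\<^bsub>F\<^esub> \<in> N" using MN subringE(3)[OF subfieldE(1)[OF M]] by blast
      show "\<And>a. a \<in> N \<Longrightarrow> \<ominus>\<^bsub>F\<^esub> a \<in> N" using neg hG NI by blast
      show "\<And>a b. a \<in> N \<Longrightarrow> b \<in> N \<Longrightarrow> a \<otimes>\<^bsub>F\<^esub> b \<in> N" using mult hG NI by blast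
      show "\<And>a b. a \<in> N \<Longrightarrow> b \<in> N \<Longrightarrow> a \<oplus>\<^bsub>F\<^esub> b \<in> N" using add hG NI by blast
      show "\<And>k. k \<in> N - {\<zero>\<^bsub>F\<^esub>} \<Longrightarrow> inv\<^bsub>F\<^esub> k \<in> N" using inv hG NI by blast
    qed
    moreover have "h \<in> ring_hom (F\<lparr>carrier := N\<rparr>) L"
    proof (rule ring_hom_memI, simp_all)
      show "\<And>x. x \<in> N \<Longrightarrow> h x \<in> carrier L" using inF hG by blast
      show "\<And>x y. x \<in> N \<Longrightarrow> y \<in> N \<Longrightarrow> h (x \<otimes>\<^bsub>F\<^esub> y) = h x \<otimes>\<^bsub>L\<^esub> h y" using h mult hG by blast
      show "\<And>x y. x \<in> N \<Longrightarrow> y \<in> N \<Longrightarrow> h (x \<oplus>\<^bsub>F\<^esub> y) = h x \<oplus>\<^bsub>L\<^esub> h y" using h add hG by blast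
      have "g \<one>\<^bsub>F\<^esub> = \<one>\<^bsub>L\<^esub>" using ring_hom_one[OF g] by simp
      thus "h \<one>\<^bsub>F\<^esub> = \<one>\<^bsub>L\<^esub>" using h base[OF subringE(3)[OF subfieldE(1)[OF M]]] by simp
    qed
    moreover have "G = (\<lambda>a. (a, h a)) ` N"
      using hG h NI by (auto simp: image_iff)
    ultimately show ?thesis using MN h base by blast
  qed
  have "\<exists>G\<in>\<A>. \<forall>H\<in>\<A>. G \<subseteq> H \<longrightarrow> H = G"
  proof (rule subset_Zorn_nonempty)
    show "\<A> \<noteq> {}" using from_hom[OF M _ g] by blast
  next
    fix C assume "C \<noteq> {}" and C: "subset.chain \<A> C"
    have CA: "G \<in> \<A>" if "G \<in> C" for G
      using C that by (auto simp: subset.chain_def)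
    have two: "\<exists>G\<in>C. x \<in> G \<and> y \<in> G" if xy: "x \<in> \<Union>C" "y \<in> \<Union>C" for x y
    proof -
      obtain H H' where XY: "H \<in> C" "H' \<in> C" "x \<in> H" "y \<in> H'" using xy by blast
      have "H \<subseteq> H' \<or> H' \<subseteq> H" using C XY(1,2) by (simp add: subset_chain_def)
      thus ?thesis using XY by blast
    qed
    note A = CA[unfolded \<A>_def mem_Collect_eq]
    show "\<Union>C \<in> \<A>" unfolding \<A>_def mem_Collect_eq
    proof (intro conjI allI impI)
      show "(\<lambda>a. (a, g a)) ` M \<subseteq> \<Union>C" using A \<open>C \<noteq> {}\<close> by blast
      show "\<Union>C \<subseteq> carrier F \<times> carrier L" using A by blast
    next
      fix a b c d assume "(a, b) \<in> \<Union>C" "(c, d) \<in> \<Union>C"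
      then obtain G where G: "G \<in> C" "(a, b) \<in> G" "(c, d) \<in> G" using two by blast
      show "(a \<oplus>\<^bsub>F\<^esub> c, b \<oplus>\<^bsub>L\<^esub> d) \<in> \<Union>C" "(a \<otimes>\<^bsub>F\<^esub> c, b \<otimes>\<^bsub>L\<^esub> d) \<in> \<Union>C"
        using A[OF G(1)] G by (meson UnionI)+
    next
      fix a b assume "(a, b) \<in> \<Union>C" thus "(\<ominus>\<^bsub>F\<^esub> a, \<ominus>\<^bsub>L\<^esub> b) \<in> \<Union>C" using A by (meson UnionE UnionI)
    next
      fix a b assume "(a, b) \<in> \<Union>C" "a \<noteq> \<zero>\<^bsub>F\<^esub>" thus "\<exists>c. (inv\<^bsub>F\<^esub> a, c) \<in> \<Union>C" using A by (meson UnionE UnionI)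
    next
      fix b assume "(\<zero>\<^bsub>F\<^esub>, b) \<in> \<Union>C" thus "b = \<zero>\<^bsub>L\<^esub>" using A by (meson UnionE)
    qed
  qed
  then obtain G where G: "G \<in> \<A>" and max: "\<And>H. H \<in> \<A> \<Longrightarrow> G \<subseteq> H \<Longrightarrow> H = G" by blast
  obtain N h where N: "subfield N F" "M \<subseteq> N" and h: "h \<in> ring_hom (F\<lparr>carrier := N\<rparr>) L"
      "\<forall>a\<in>M. h a = g a" and Geq: "G = (\<lambda>a. (a, h a)) ` N"
    using to_hom[OF G] by blast
  have "x \<in> N" if x: "x \<in> carrier F" for x
  proof -
    have algN: "(F.algebraic over N) x"
      using F.algebraic_mono[OF N(2)] alg[OF x] by (simp add: over_def)
    have FN: "field (F\<lparr>carrier := N\<rparr>)" using F.subfield_iff(2)[OF N(1)] .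
    have irr: "F.Irr N x \<in> carrier (univ_poly F N)" "pirreducible\<^bsub>F\<^esub> N (F.Irr N x)"
      using F.IrrE[OF N(1) x algN] by blast+
    have "map h (F.Irr N x) \<in> carrier (poly_ring L)"
      using polynomial_hom[OF h(1) FN fL] irr(1) F.univ_poly_consistent[OF subfieldE(1)[OF N(1)]] by simp
    moreover have "degree (map h (F.Irr N x)) > 0"
      using F.pirreducible_degree[OF N(1) irr] by simp
    ultimately obtain y where y: "y \<in> carrier L" "L.eval (map h (F.Irr N x)) y = \<zero>\<^bsub>L\<^esub>"
      using L.exists_root_over_carrier by blast
    obtain k where k: "k \<in> ring_hom (F\<lparr>carrier := F.simple_extension N x\<rparr>) L"
      "\<And>a. a \<in> N \<Longrightarrow> k a = h a"
      using simple_extension_hom[OF assms(1) fL N(1) h(1) x _ y] algN by (auto simp: over_def)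
    have se: "subfield (F.simple_extension N x) F"
      using F.simple_extension_is_subfield[OF N(1) x] algN by simp
    have NS: "N \<subseteq> F.simple_extension N x"
      using F.simple_extension_incl[OF subfieldE(3)[OF N(1)] x] .
    have "(\<lambda>a. (a, k a)) ` F.simple_extension N x \<in> \<A>"
    proof (rule from_hom[OF se _ k(1)])
      show "M \<subseteq> F.simple_extension N x" using N(2) NS by (rule subset_trans)
      show "\<And>a. a \<in> M \<Longrightarrow> k a = g a" using k(2) h(2) N(2) by (metis subsetD)
    qed
    moreover have "G \<subseteq> (\<lambda>a. (a, k a)) ` F.simple_extension N x"
      using NS k(2) unfolding Geq by (auto simp: image_iff)
    ultimately have "(\<lambda>a. (a, k a)) ` F.simple_extension N x = G" by (rule max)
    hence "fst ` (\<lambda>a. (a, k a)) ` F.simple_extension N x = fst ` G" by simp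
    hence "F.simple_extension N x = N" unfolding Geq by (simp add: image_image)
    thus "x \<in> N" using F.simple_extension_mem[OF subfieldE(1)[OF N(1)] x] by simp
  qed
  hence "N = carrier F" using subfieldE(3)[OF N(1)] by blast
  thus thesis using that[of h] h by simp
qed

subsection \<open>Fixed points of pro-\<open>p\<close> groups\<close>

text \<open>Orbit lengths divide the group order, so each is a power of \<open>p\<close>; without
  fixed points no orbit has length one, and \<open>p\<close> divides every summand of the orbit
  decomposition.\<close>

lemma (in group_action) dvd_card_if_no_fixed_points:
  assumes "Factorial_Ring.prime (p::nat)" and "order G = p ^ n" and "finite E"
    and nofix: "\<And>x. x \<in> E \<Longrightarrow> \<exists>g\<in>carrier G. \<phi> g x \<noteq> x"
  shows "p dvd card E"
proof -
  have "p dvd card B" if B: "B \<in> orbits G E \<phi>" for B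
  proof -
    obtain x where x: "x \<in> E" "B = orbit G \<phi> x" using B by (auto simp: orbits_def)
    have "card B dvd p ^ n"
      using orbit_stabilizer_theorem[OF x(1)] assms(2) x(2) by (metis dvd_triv_left)
    then obtain k where k: "card B = p ^ k"
      using assms(1) divides_primepow_nat by blast
    have "k \<noteq> 0"
    proof
      assume "k = 0"
      hence "card B = 1" using k by simp
      then obtain y where "B = {y}" by (auto simp: card_1_singleton_iff)
      moreover have "x \<in> B" using orbit_refl[OF x(1)] x(2) by simp
      ultimately have "B = {x}" by auto
      moreover obtain g where "g \<in> carrier G" "\<phi> g x \<noteq> x" using nofix[OF x(1)] by blast
      ultimately show False unfolding x(2) orbit_def by blast
    qed
    thus ?thesis using k by (simp add: dvd_power)
  qed
  moreover have "card E = (\<Sum>B\<in>orbits G E \<phi>. card B)"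
    using disjoint_sum[OF assms(3), of "\<lambda>_. 1::nat"] by simp
  ultimately show ?thesis by (simp add: dvd_sum)
qed

text \<open>The action factors through \<open>G Mod N\<close> for its kernel \<open>N\<close>. As
  \<open>N\<close> is open, the quotient has \<open>p\<close>-power order, and so has the isomorphic
  group \<open>H\<close> of permutations of \<open>Y\<close>. This reduces the claim to orbit
  counting for a finite \<open>p\<close>-group.\<close>

lemma pro_p_group_fixed_point:
  assumes p: "Factorial_Ring.prime p" and pro: "pro_p_group p G T"
    and act: "group_action G Y \<phi>" and fin: "finite Y" and nd: "\<not> p dvd card Y"
    and op: "openin T {g \<in> carrier G. \<forall>y\<in>Y. \<phi> g y = y}"
  obtains y where "y \<in> Y" "\<And>g. g \<in> carrier G \<Longrightarrow> \<phi> g y = y"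
proof -
  interpret group_action G Y \<phi> by fact
  interpret h: group_hom G "BijGroup Y" \<phi> by (rule group_hom)
  have ext: "\<phi> g \<in> extensional Y" if "g \<in> carrier G" for g
    using bij_prop0[OF that] by (rule Bij_imp_extensional)
  have one: "\<one>\<^bsub>BijGroup Y\<^esub> = (\<lambda>y\<in>Y. y)" by (simp add: BijGroup_def)
  define N where "N = kernel G (BijGroup Y) \<phi>"
  \<comment> \<open>Elements of \<open>BijGroup Y\<close> are extensional, so being its unit is the
    same as fixing \<open>Y\<close> pointwise.\<close>
  have "N = {g \<in> carrier G. \<forall>y\<in>Y. \<phi> g y = y}"
    unfolding N_def kernel_def one using ext by (auto simp: extensional_def fun_eq_iff restrict_def)
  hence "openin T N" using op by simp
  moreover have N: "N \<lhd> G" unfolding N_def by (rule h.normal_kernel)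
  ultimately obtain n where n: "card (rcosets\<^bsub>G\<^esub> N) = p ^ n"
    using pro by (auto simp: pro_p_group_def)
  define H where "H = \<phi> ` carrier G"
  have "group G" using pro by (simp add: pro_p_group_def profinite_group_def topological_group_def)
  hence H: "subgroup H (BijGroup Y)"
    unfolding H_def by (intro h.subgroup_img_is_subgroup group.subgroup_self)
  interpret hH: group_hom G "(BijGroup Y)\<lparr>carrier := H\<rparr>" \<phi>
    using \<open>group G\<close> subgroup.subgroup_is_group[OF H group_BijGroup] h.homh
    by (auto simp: group_hom_def group_hom_axioms_def hom_def H_def)
  have "G Mod N \<cong> (BijGroup Y)\<lparr>carrier := H\<rparr>"
    using hH.FactGroup_iso by (simp add: H_def N_def kernel_def)
  hence "order ((BijGroup Y)\<lparr>carrier := H\<rparr>) = p ^ n"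
    using iso_same_card n by (fastforce simp: order_def FactGroup_def)
  moreover have "group_action ((BijGroup Y)\<lparr>carrier := H\<rparr>) Y (\<lambda>f. f)"
  proof -
    have "group_action (BijGroup Y) Y (\<lambda>f. f)"
      unfolding group_action_def group_hom_def group_hom_axioms_def
      by (simp add: group_BijGroup hom_def)
    thus ?thesis using group_action.induced_action H by blast
  qed
  ultimately have "\<exists>y\<in>Y. \<forall>f\<in>H. f y = y"
    using group_action.dvd_card_if_no_fixed_points[OF _ p _ fin, of _ "\<lambda>f. f" n] nd by fastforce
  thus thesis using that unfolding H_def by blast
qed

subsection \<open>Powers of linear polynomials and pure inseparability\<close>

text \<open>Coefficient lists start with the leading coefficient, so \<open>[\<one>, a]\<close> is X
  + a. Multiplying by it adds a copy of \<open>q\<close> shifted by one degree to a copy scaled by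
  \<open>a\<close>.\<close>

lemma (in domain) coeff_linear_mult:
  assumes "a \<in> carrier R" and "set q \<subseteq> carrier R"
  shows "coeff (poly_mult [\<one>, a] q) k = (if k = 0 then \<zero> else coeff q (k - 1)) \<oplus> a \<otimes> coeff q k"
proof -
  have ma: "set (map ((\<otimes>) a) q) \<subseteq> carrier R" and m1: "set (map ((\<otimes>) \<one>) q @ [\<zero>]) \<subseteq> carrier R"
    using assms by auto
  have "poly_mult [\<one>, a] q = poly_add (map ((\<otimes>) \<one>) q @ [\<zero>]) (poly_add (map ((\<otimes>) a) q) [])"
    by simp
  also have "coeff \<dots> k = coeff (map ((\<otimes>) \<one>) q @ [\<zero>]) k \<oplus> coeff (map ((\<otimes>) a) q) k"
    using poly_add_coeff[OF m1 poly_add_in_carrier[OF ma, of "[]"]] poly_add_coeff[OF ma, of "[]"]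
      coeff_in_carrier[OF ma] by simp
  finally show ?thesis
    using scalar_coeff[OF assms(1), of q] scalar_coeff[OF one_closed, of q] coeff_in_carrier[OF assms(2)]
    by (auto simp: append_coeff)
qed

text \<open>The binomial theorem for X + a, with Pascal's rule as induction step. For
  \<open>k > n\<close> the truncated exponent \<open>n - k\<close> is harmless because the binomial
  coefficient is zero.\<close>

lemma (in domain) coeff_linear_power:
  assumes a: "a \<in> carrier R"
  shows "coeff ([\<one>, a] [^]\<^bsub>poly_ring R\<^esub> (n::nat)) k = add_pow R (n choose k) (a [^] (n - k))"
proof (induction n arbitrary: k)
  case 0
  show ?case by (cases k) (simp_all add: univ_poly_one)
next
  case (Suc n)
  interpret UP: domain "poly_ring R" by (rule univ_poly_is_domain[OF carrier_is_subring])
  have la: "[\<one>, a] \<in> carrier (poly_ring R)"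
    using a by (simp add: univ_poly_carrier[symmetric] polynomial_def)
  let ?q = "[\<one>, a] [^]\<^bsub>poly_ring R\<^esub> n"
  have q: "?q \<in> carrier (poly_ring R)" using la by simp
  hence sq: "set ?q \<subseteq> carrier R" using polynomial_incl univ_poly_carrier by blast
  have "[\<one>, a] [^]\<^bsub>poly_ring R\<^esub> Suc n = poly_mult [\<one>, a] ?q"
    using UP.m_comm[OF la q] by (simp add: univ_poly_mult)
  hence *: "coeff ([\<one>, a] [^]\<^bsub>poly_ring R\<^esub> Suc n) k
      = (if k = 0 then \<zero> else coeff ?q (k - 1)) \<oplus> a \<otimes> coeff ?q k"
    using coeff_linear_mult[OF a sq] by simp
  show ?case
  proof (cases k)
    case 0
    thus ?thesis unfolding * Suc using a by (simp add: m_comm)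
  next
    case (Suc j)
    have "a \<otimes> add_pow R (n choose k) (a [^] (n - k)) = add_pow R (n choose k) (a [^] (n - j))"
    proof (cases "k \<le> n")
      case True
      hence "a [^] (n - j) = a \<otimes> a [^] (n - k)"
        using a Suc by (metis Suc_diff_le diff_Suc_Suc m_comm nat_pow_Suc nat_pow_closed)
      thus ?thesis using a add_pow_rdistr by simp
    next
      case False
      thus ?thesis using a by (simp add: binomial_eq_0)
    qed
    thus ?thesis unfolding * Suc.IH using Suc a
      by (simp add: add.nat_pow_mult)
  qed
qed

lemma (in domain) eval_linear_power:
  assumes a: "a \<in> carrier R" and z: "z \<in> carrier R"
  shows "eval ([\<one>, a] [^]\<^bsub>poly_ring R\<^esub> (n::nat)) z = (z \<oplus> a) [^] n"
proof -
  have la: "[\<one>, a] \<in> carrier (poly_ring R)"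
    using a by (simp add: univ_poly_carrier[symmetric] polynomial_def)
  interpret e: ring_hom_ring "poly_ring R" R "\<lambda>p. eval p z"
    by (rule eval_ring_hom[OF carrier_is_subring z])
  show ?thesis using e.hom_nat_pow[OF la] a z by simp
qed

lemma (in domain) nat_pow_eq_zeroD: "x \<in> carrier R \<Longrightarrow> x [^] (n::nat) = \<zero> \<Longrightarrow> x = \<zero>"
  by (induction n) (auto simp: integral_iff)

text \<open>In characteristic \<open>q\<close> the inner binomial coefficients vanish, so the
  \<open>q\<close>-th power of y - x depends on \<open>y\<close> only through its
  \<open>q\<close>-th power and agrees with that of x - x. Keeping the constant term as a power of
  -x avoids separating \<open>q = 2\<close> from odd \<open>q\<close>.\<close>

lemma (in domain) frobenius_inj:
  assumes q: "Factorial_Ring.prime (q::nat)" "add_pow R q \<one> = \<zero>"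
    and x: "x \<in> carrier R" and y: "y \<in> carrier R" and eq: "x [^] q = y [^] q"
  shows "x = y"
proof -
  define c where "c = (\<ominus> x) [^] q"
  have c: "c \<in> carrier R" using x by (simp add: c_def)
  have q0: "q > 1" using q(1) prime_gt_1_nat by blast
  have la: "[\<one>, \<ominus> x] \<in> carrier (poly_ring R)"
    using x by (simp add: univ_poly_carrier[symmetric] polynomial_def)
  interpret UP: domain "poly_ring R" by (rule univ_poly_is_domain[OF carrier_is_subring])
  have mult0: "add_pow R n z = \<zero>" if "q dvd n" "z \<in> carrier R" for n z
  proof -
    from that(1) obtain m where "n = q * m" by (rule dvdE)
    hence "add_pow R n \<one> = \<zero>" using add.nat_pow_pow[of \<one> m q] q(2) by simp
    thus ?thesis using add_pow_ldistr[of \<one> z n] that(2) by simp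
  qed
  \<comment> \<open>\<open>(X - x)\<^sup>q = X\<^sup>q + (-x)\<^sup>q\<close>, evaluated below at \<open>x\<close> and at \<open>y\<close>.\<close>
  have "[\<one>, \<ominus> x] [^]\<^bsub>poly_ring R\<^esub> q = monom \<one> (q - 1) @ [c]"
  proof -
    have p1: "polynomial (carrier R) ([\<one>, \<ominus> x] [^]\<^bsub>poly_ring R\<^esub> q)"
      using UP.nat_pow_closed[OF la] by (simp add: univ_poly_carrier)
    \<comment> \<open>Appending \<open>c\<close> to the list of the monomial of degree
      \<open>q - 1\<close> raises that monomial to degree \<open>q\<close> and makes
      \<open>c\<close> the constant term.\<close>
    have p2: "polynomial (carrier R) (monom \<one> (q - 1) @ [c])"
      using c by (auto simp: monom_def polynomial_def)
    have "coeff ([\<one>, \<ominus> x] [^]\<^bsub>poly_ring R\<^esub> q) k = coeff (monom \<one> (q - 1) @ [c]) k" for k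
    proof -
      consider "k = 0" | "k = q" | "k \<noteq> 0" "k < q" | "k > q" by linarith
      thus ?thesis
      proof cases
        case 3
        hence "q dvd (q choose k)" using q(1) by (intro dvd_choose_prime) auto
        thus ?thesis using 3 x by (simp add: coeff_linear_power append_coeff monom_coeff mult0)
      qed (use q0 x in \<open>simp_all add: coeff_linear_power append_coeff monom_coeff c_def binomial_eq_0\<close>)
    qed
    thus ?thesis using coeff_iff_polynomial_cond[OF p1 p2] by blast
  qed
  hence ev: "(z \<oplus> \<ominus> x) [^] q = z [^] q \<oplus> c" if z: "z \<in> carrier R" for z
    using eval_linear_power[of "\<ominus> x" z q] eval_append_aux[of "monom \<one> (q - 1)" c z]
      eval_monom[of \<one> z "q - 1"] x z c q0 nat_pow_Suc[of z "q - 1"] by (simp add: monom_in_carrier)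
  have "(y \<oplus> \<ominus> x) [^] q = (x \<oplus> \<ominus> x) [^] q" unfolding ev[OF x] ev[OF y] eq ..
  also have "\<dots> = \<zero>" using x q0 by (simp add: r_neg nat_pow_zero)
  finally have "y \<oplus> \<ominus> x = \<zero>" by (rule nat_pow_eq_zeroD[rotated]) (simp add: x y)
  hence "\<ominus> (\<ominus> x) = y" by (rule minus_equality) (simp_all add: x y)
  thus ?thesis using x by simp
qed

text \<open>The multiples of one multiply like their coefficients, so a proper factorization of the
  least positive annihilator of one would give a smaller annihilator in a domain. Division with
  remainder shows that this prime divides every annihilator.\<close>

lemma (in domain) char_exponent_cases:
  obtains "char_exponent R = 1" "\<And>n::nat. n > 0 \<Longrightarrow> add_pow R n \<one> \<noteq> \<zero>"
  | "Factorial_Ring.prime (char_exponent R)" "\<And>n::nat. add_pow R n \<one> = \<zero> \<longleftrightarrow> char_exponent R dvd n"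
proof (cases "\<exists>n::nat. 0 < n \<and> add_pow R n \<one> = \<zero>")
  case False
  hence "char_exponent R = 1" unfolding char_exponent_def by (rule if_not_P)
  thus thesis using that(1) False by blast
next
  case True
  define q where "q = char_exponent R"
  have qdef: "q = (LEAST n::nat. 0 < n \<and> add_pow R n \<one> = \<zero>)"
    using True by (simp add: q_def char_exponent_def)
  have q: "0 < q" "add_pow R q \<one> = \<zero>" using LeastI_ex[OF True] by (simp_all add: qdef)
  have least: "q \<le> n" if "0 < n" "add_pow R n \<one> = \<zero>" for n :: nat
    using Least_le[of _ n] that by (simp add: qdef)
  have mult: "add_pow R (a * b) \<one> = add_pow R a \<one> \<otimes> add_pow R b \<one>" for a b :: nat
    using add_pow_ldistr[of \<one> "add_pow R b \<one>" a] add.nat_pow_pow[of \<one> a b] by (simp add: mult.commute)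
  have "q \<noteq> 1" using q by auto
  have "Factorial_Ring.prime q"
  proof (rule ccontr)
    assume "\<not> Factorial_Ring.prime q"
    then obtain a where a: "a dvd q" "a \<noteq> 1" "a \<noteq> q"
      using \<open>q \<noteq> 1\<close> q(1) unfolding prime_nat_iff by auto
    from a(1) obtain b where b: "q = a * b" by (rule dvdE)
    have ab: "q = a * b" "a \<noteq> 1" "b \<noteq> 1" using a b by auto
    hence "a < q" "b < q" "a > 0" "b > 0" using q(1) by (auto intro!: Nat.gr0I)
    moreover have "add_pow R a \<one> = \<zero> \<or> add_pow R b \<one> = \<zero>"
      using q(2) mult[of a b] ab(1) integral by simp
    ultimately show False using least[of a] least[of b] by linarith
  qed
  moreover have "add_pow R n \<one> = \<zero> \<longleftrightarrow> q dvd n" for n :: nat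
  proof
    assume "q dvd n" thus "add_pow R n \<one> = \<zero>" using mult q(2) by (auto simp: dvd_def)
  next
    assume n: "add_pow R n \<one> = \<zero>"
    have "add_pow R (q * (n div q)) \<one> \<oplus> add_pow R (n mod q) \<one> = add_pow R n \<one>"
      using add.nat_pow_mult[of \<one> "q * (n div q)" "n mod q"] by simp
    hence "add_pow R (n mod q) \<one> = \<zero>" using n mult[of q "n div q"] q(2) by simp
    hence "n mod q = 0" using least[of "n mod q"] mod_less_divisor[OF q(1), of n] by fastforce
    thus "q dvd n" by auto
  qed
  ultimately show thesis using that(2) by (simp add: q_def)
qed

text \<open>The polynomial splits, so the multiplicity of its only root \<open>x\<close> is the
  whole degree. The cofactor of the corresponding power of X - x is therefore a constant, and
  comparing leading coefficients shows that it is one.\<close>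

lemma (in algebraically_closed) single_root_imp_linear_power:
  assumes p: "p \<in> carrier (poly_ring L)" "lead_coeff p = \<one>" "p \<noteq> []" and x: "x \<in> carrier L"
    and root: "\<And>y. y \<in> carrier L \<Longrightarrow> eval p y = \<zero> \<Longrightarrow> y = x"
  shows "p = [\<one>, \<ominus> x] [^]\<^bsub>poly_ring L\<^esub> degree p"
proof -
  interpret UP: domain "poly_ring L" by (rule univ_poly_is_domain[OF carrier_is_subring])
  have la: "[\<one>, \<ominus> x] \<in> carrier (poly_ring L)"
    using x by (simp add: univ_poly_carrier[symmetric] polynomial_def)
  define m where "m = alg_mult p x"
  let ?q = "[\<one>, \<ominus> x] [^]\<^bsub>poly_ring L\<^esub> m"
  have q: "?q \<in> carrier (poly_ring L)" using la by simp
  have "set_mset (roots p) \<subseteq> {x}"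
    using root roots_mem_iff_is_root[OF p(1)] by (auto simp: is_root_def)
  hence "roots p = replicate_mset (size (roots p)) x" by (rule set_mset_subset_singletonD)
  from arg_cong[OF this, of "\<lambda>M. count M x"] have "count (roots p) x = size (roots p)" by simp
  hence "size (roots p) = m" using alg_mult_eq_count_roots[OF p(1)] by (simp add: m_def)
  hence deg: "degree p = m" using roots_over_carrier[OF p(1)] by (simp add: splitted_def)
  obtain r where r: "r \<in> carrier (poly_ring L)" "p = ?q \<otimes>\<^bsub>poly_ring L\<^esub> r"
    using alg_multE(1)[OF x p(1,3)] by (auto simp: pdivides_def factor_def m_def)
  have r0: "r \<noteq> []" using p(3) r(2) UP.r_null[OF q] by (auto simp: univ_poly_zero)
  have q0: "?q \<noteq> []" using polynomial_pow_not_zero[OF la] by simp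
  have "degree ?q = m" using polynomial_pow_degree[OF la] by simp
  hence "degree r = 0"
    using poly_mult_degree_eq[OF carrier_is_subring, of ?q r] deg q r q0 r0
    by (simp add: univ_poly_carrier univ_poly_mult)
  then obtain c where c: "r = [c]" using r0 by (cases r) auto
  have cc: "c \<in> carrier L" using r(1) c by (simp add: univ_poly_carrier[symmetric] polynomial_def)
  have pq: "p = poly_mult [c] ?q" using r UP.m_comm[OF q r(1)] c by (simp add: univ_poly_mult)
  have sq: "set ?q \<subseteq> carrier L" using q polynomial_incl univ_poly_carrier by blast
  have ms: "set (map ((\<otimes>) c) ?q) \<subseteq> carrier L" using sq cc by auto
  have coeff: "coeff p k = c \<otimes> coeff ?q k" for k
    unfolding pq using poly_add_coeff[OF ms, of "[]"] coeff_in_carrier[OF ms] scalar_coeff[OF cc, of ?q] by simp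
  have "\<one> = coeff p m" using deg p(2,3) by (metis lead_coeff_simp)
  also have "\<dots> = c" using coeff coeff_linear_power[of "\<ominus> x" m m] x cc by simp
  finally have "coeff p = coeff ?q" using coeff coeff_in_carrier[OF sq] by auto
  hence "p = ?q" using coeff_iff_polynomial_cond[of "carrier L" p ?q] p(1) q univ_poly_carrier by blast
  thus ?thesis using deg by simp
qed

lemma (in domain) frobenius_pow_inj:
  assumes x: "x \<in> carrier R" and y: "y \<in> carrier R"
    and eq: "x [^] (char_exponent R ^ n) = y [^] (char_exponent R ^ n)"
  shows "x = y"
proof (cases rule: char_exponent_cases)
  case 1
  thus ?thesis using x y eq by simp
next
  case 2
  let ?q = "char_exponent R"
  have q: "add_pow R ?q \<one> = \<zero>" using 2(2)[of ?q] by simp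
  show ?thesis using eq
  proof (induction n)
    case 0
    thus ?case using x y by simp
  next
    case (Suc n)
    have "(x [^] (?q ^ n)) [^] ?q = (y [^] (?q ^ n)) [^] ?q"
      using Suc.prems x y by (simp add: nat_pow_pow mult.commute)
    hence "x [^] (?q ^ n) = y [^] (?q ^ n)"
      by (rule frobenius_inj[OF 2(1) q, rotated 2]) (simp_all add: x y)
    thus ?case by (rule Suc.IH)
  qed
qed

text \<open>The minimal polynomial is a power of X - x with all coefficients in \<open>K\<close>. A
  coefficient with invertible binomial factor then puts a suitable power of \<open>x\<close> into
  \<open>K\<close>.\<close>

lemma (in algebraically_closed) single_conjugate_imp_purely_inseparable:
  assumes K: "subfield K L" and x: "x \<in> carrier L" and alg: "(algebraic over K) x"
    and root: "\<And>y. y \<in> carrier L \<Longrightarrow> eval (Irr K x) y = \<zero> \<Longrightarrow> y = x"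
  obtains n :: nat where "x [^] (char_exponent L ^ n) \<in> K"
proof -
  note irr = IrrE[OF K x alg]
  note sK = subringE[OF subfieldE(1)[OF K]]
  let ?f = "Irr K x"
  define m where "m = degree ?f"
  have f: "?f \<in> carrier (poly_ring L)" using irr(1) carrier_polynomial_shell subfieldE(1)[OF K] by blast
  have m1: "m \<ge> 1" using pirreducible_degree[OF K irr(1,2)] by (simp add: m_def)
  hence f0: "?f \<noteq> []" by (auto simp: m_def)
  have "?f = [\<one>, \<ominus> x] [^]\<^bsub>poly_ring L\<^esub> m"
    unfolding m_def by (rule single_root_imp_linear_power[OF f irr(3) f0 x root])
  hence coeff: "coeff ?f k = add_pow L (m choose k) ((\<ominus> x) [^] (m - k))" for k
    using coeff_linear_power[of "\<ominus> x" m k] x by simp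
  have "set ?f \<subseteq> K" using irr(1) polynomial_incl univ_poly_carrier by blast
  hence "range (coeff ?f) \<subseteq> K" using coeff_img(3)[of ?f] sK(2) by simp
  hence coeffK: "coeff ?f k \<in> K" for k by (simp only: subset_iff rangeI)
  \<comment> \<open>For the largest power \<open>Q\<close> of the characteristic exponent dividing \<open>m\<close>, the binomial coefficient
    \<open>m choose Q\<close> is invertible in \<open>L\<close>; \<open>x\<^sup>Q\<close> is then read off the coefficient of \<open>X\<^sup>m\<^sup>-\<^sup>Q\<close> in \<open>(X - x)\<^sup>m\<close>.\<close>
  have "\<exists>n Q::nat. Q = char_exponent L ^ n \<and> Q \<le> m \<and> add_pow L (m choose Q) \<one> \<noteq> \<zero>"
  proof (cases rule: char_exponent_cases)
    case 1
    \<comment> \<open>Here \<open>Q = 1\<close>, and the binomial coefficient is \<open>m\<close>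
      itself, a positive integer.\<close>
    thus ?thesis using m1 by (intro exI[of _ 0] exI[of _ 1]) simp
  next
    case 2
    let ?q = "char_exponent L"
    have "\<not> is_unit ?q" using 2(1) by (metis not_prime_unit)
    then obtain e r where r: "m = ?q ^ e * r" "\<not> ?q dvd r"
      using multiplicity_decompose'[of m ?q] m1 by (metis not_one_le_zero)
    have r0: "r > 0" using r(2) by (auto intro!: Nat.gr0I)
    let ?Q = "?q ^ e"
    have Qm: "?Q \<le> m" using r(1) r0 by simp
    \<comment> \<open>By \<open>const_p_fac\<close>, the binomial fact behind Sylow's theorem, this
      multiplicity equals that of \<open>?q\<close> in \<open>r\<close>, which is zero.\<close>
    have "multiplicity ?q (m choose ?Q) = 0"
      using const_p_fac[OF r0 2(1), of e] r by (simp add: not_dvd_imp_multiplicity_0)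
    hence "\<not> ?q dvd (m choose ?Q)"
      using Qm \<open>\<not> is_unit ?q\<close> by (simp add: multiplicity_eq_zero_iff)
    thus ?thesis using 2(2) Qm by blast
  qed
  then obtain n Q :: nat where Q: "Q = char_exponent L ^ n" "Q \<le> m" "add_pow L (m choose Q) \<one> \<noteq> \<zero>"
    by blast
  define C where "C = add_pow L (m choose Q) \<one>"
  have addK: "add_pow L k \<one> \<in> K" for k :: nat using sK(2,3,7) by (induction k) auto
  have negK: "\<ominus> \<one> [^] k \<in> K" for k :: nat using sK(3,5,6) by (induction k) auto
  have C: "C \<in> K" "C \<noteq> \<zero>" "C \<in> carrier L" using addK Q(3) sK(1) by (auto simp: C_def)
  have "C \<otimes> (\<ominus> x) [^] Q = coeff ?f (m - Q)"
    using Q(2) x add_pow_ldistr[of \<one> "(\<ominus> x) [^] Q" "m choose Q"] coeff[of "m - Q"] binomial_symmetric[OF Q(2)]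
    by (simp add: C_def)
  hence 1: "C \<otimes> (\<ominus> x) [^] Q \<in> K" using coeffK by simp
  have "inv C \<in> K" using subfield_m_inv(1)[OF K] C by simp
  hence "inv C \<otimes> (C \<otimes> (\<ominus> x) [^] Q) \<in> K" using 1 sK(6) by blast
  moreover have "inv C \<otimes> (C \<otimes> (\<ominus> x) [^] Q) = (\<ominus> x) [^] Q"
    using C x field_Units by (simp add: m_assoc[symmetric])
  ultimately have "(\<ominus> x) [^] Q \<in> K" by simp
  \<comment> \<open>The sign is removed by a power of -1, which lies in \<open>K\<close>, so that
    the parity of \<open>Q\<close> does not matter.\<close>
  hence "(\<ominus> \<one>) [^] Q \<otimes> (\<ominus> x) [^] Q \<in> K" using negK sK(6) by blast
  moreover have "(\<ominus> \<one>) [^] Q \<otimes> (\<ominus> x) [^] Q = x [^] Q"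
    using x nat_pow_distrib[of "\<ominus> \<one>" "\<ominus> x" Q] by (simp add: l_minus r_minus)
  ultimately have "x [^] Q \<in> K" by simp
  thus thesis using that Q(1) by simp
qed

subsection \<open>The fixed field of the automorphism group\<close>

lemma aut_group_carrier:
  "carrier (aut_group L K) = {\<theta> \<in> ring_hom L L. \<theta> \<in> Bij (carrier L) \<and> (\<forall>x\<in>K. \<theta> x = x)}"
  by (simp add: aut_group_def)

lemma aut_group_apply:
  assumes "\<theta> \<in> carrier (aut_group L K)" "\<tau> \<in> carrier (aut_group L K)" "x \<in> carrier L"
  shows "(\<theta> \<otimes>\<^bsub>aut_group L K\<^esub> \<tau>) x = \<theta> (\<tau> x)"
  using assms by (simp add: aut_group_def BijGroup_def compose_eq)

lemma aut_group_one: "\<one>\<^bsub>aut_group L K\<^esub> = (\<lambda>x\<in>carrier L. x)"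
  by (simp add: aut_group_def BijGroup_def)

text \<open>A homomorphism of fields is injective. It maps the finite root set of each polynomial
  over the base field into itself, hence onto itself, and every element of \<open>L\<close> is such
  a root.\<close>

lemma (in algebraic_closure) endomorphism_bij:
  assumes \<theta>: "\<theta> \<in> ring_hom L L" and fix': "\<And>e. e \<in> K \<Longrightarrow> \<theta> e = e"
  shows "bij_betw \<theta> (carrier L) (carrier L)"
proof -
  have K: "subfield K L" by (rule subfield_axioms)
  interpret s: ring_hom_ring L L \<theta>
    using ring_hom_ringI2[OF ring_axioms ring_axioms \<theta>] .
  have inj: "inj_on \<theta> (carrier L)"
    using non_trivial_field_hom_is_inj[OF \<theta> field_axioms field_axioms] one_not_zero by simp
  have "y \<in> \<theta> ` carrier L" if y: "y \<in> carrier L" for y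
  proof -
    obtain p where p: "p \<in> carrier (K[X])" "p \<noteq> []" "eval p y = \<zero>"
      using algebraicE[OF subfieldE(1)[OF K] y algebraic_extension[OF y]] by blast
    have pL: "p \<in> carrier (poly_ring L)" using carrier_polynomial_shell[OF subfieldE(1)[OF K] p(1)] .
    have "set p \<subseteq> K" using p(1) polynomial_incl univ_poly_carrier by blast
    hence map_p: "map \<theta> p = p" using fix' by (auto intro: map_idI)
    define R where "R = {z. is_root p z}"
    have fin: "finite R" unfolding R_def by (rule finite_number_of_roots[OF pL])
    have RL: "R \<subseteq> carrier L" by (auto simp: R_def is_root_def)
    have "\<theta> ` R \<subseteq> R"
    proof
      fix w assume "w \<in> \<theta> ` R"
      then obtain z where z: "z \<in> carrier L" "eval p z = \<zero>" "w = \<theta> z" by (auto simp: R_def is_root_def)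
      have "eval p w = \<theta> (eval p z)"
        using s.eval_hom[OF carrier_is_subring z(1) pL] map_p z(3) by simp
      thus "w \<in> R" using z s.hom_closed[OF z(1)] p(2) by (simp add: R_def is_root_def)
    qed
    hence "\<theta> ` R = R" using fin inj_on_subset[OF inj RL] by (simp add: endo_inj_surj)
    moreover have "y \<in> R" using y p by (simp add: R_def is_root_def)
    ultimately show ?thesis using RL by blast
  qed
  thus ?thesis using inj s.hom_closed by (auto simp: bij_betw_def)
qed

text \<open>\<open>L\<close> is algebraic over \<open>N\<close>, so the homomorphism extends to an
  endomorphism of \<open>L\<close>; this fixes the base field and is therefore bijective.
  Restricting to the carrier supplies the extensionality that \<open>Bij\<close> demands.\<close>

lemma aut_group_extends_hom:
  assumes ac: "algebraic_closure L E" and K: "E \<subseteq> K" "K \<subseteq> N" and N: "subfield N L"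
    and \<theta>: "\<theta> \<in> ring_hom (L\<lparr>carrier := N\<rparr>) L" "\<And>x. x \<in> K \<Longrightarrow> \<theta> x = x"
  obtains \<theta>' where "\<theta>' \<in> carrier (aut_group L K)" "\<And>x. x \<in> N \<Longrightarrow> \<theta>' x = \<theta> x"
proof -
  interpret algebraic_closure L E by fact
  have "algebraic N x" if "x \<in> carrier L" for x
    using algebraic_mono[OF subset_trans[OF K]] algebraic_extension[OF that] by (simp add: over_def)
  then obtain h where h: "h \<in> ring_hom L L" "\<And>a. a \<in> N \<Longrightarrow> h a = \<theta> a"
    using hom_extends_to_algebraic_extension[OF field_axioms algebraically_closed_axioms N _ \<theta>(1)]
    by blast
  define s where "s = restrict h (carrier L)"
  have NL: "N \<subseteq> carrier L" using subfieldE(3)[OF N] .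
  have s: "s \<in> ring_hom L L" using h(1) by (auto simp: s_def ring_hom_def)
  have sN: "s x = \<theta> x" if "x \<in> N" for x using that NL h(2) by (auto simp: s_def)
  have sK: "s x = x" if "x \<in> K" for x using that K \<theta>(2) sN by auto
  have "bij_betw s (carrier L) (carrier L)"
    by (rule endomorphism_bij[OF s]) (use sK K in auto)
  hence "s \<in> Bij (carrier L)" by (simp add: Bij_def s_def)
  thus thesis using that[of s] s sK sN by (simp add: aut_group_carrier)
qed

lemma fixed_field_subfield:
  assumes "field L" and K: "K \<subseteq> carrier L"
  shows "subfield {x \<in> carrier L. \<forall>\<theta>\<in>carrier (aut_group L K). \<theta> x = x} L" (is "subfield ?Fix L")
proof -
  interpret field L by fact
  have hom: "ring_hom_ring L L \<theta>" if "\<theta> \<in> carrier (aut_group L K)" for \<theta>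
    using that ring_hom_ringI2[OF ring_axioms ring_axioms] by (auto simp: aut_group_carrier)
  show ?thesis
  proof (rule subfieldI'[OF subringI])
    fix x assume x: "x \<in> {x \<in> carrier L. \<forall>\<theta>\<in>carrier (aut_group L K). \<theta> x = x} - {\<zero>\<^bsub>L\<^esub>}"
    have "\<theta> (inv\<^bsub>L\<^esub> x) = inv\<^bsub>L\<^esub> x" if s: "\<theta> \<in> carrier (aut_group L K)" for \<theta>
    proof -
      interpret s: ring_hom_ring L L \<theta> by (rule hom[OF s])
      have xL: "x \<in> carrier L" "x \<in> Units L" and tx: "\<theta> x = x" using x s by (auto simp: field_Units)
      have ix: "inv\<^bsub>L\<^esub> x \<in> carrier L" using xL by simp
      have "x \<otimes>\<^bsub>L\<^esub> \<theta> (inv\<^bsub>L\<^esub> x) = \<theta> (x \<otimes>\<^bsub>L\<^esub> inv\<^bsub>L\<^esub> x)"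
        using s.hom_mult[OF xL(1) ix] tx by simp
      also have "\<dots> = \<one>\<^bsub>L\<^esub>" using xL by simp
      finally show ?thesis using comm_inv_char[OF xL(1) s.hom_closed[OF ix]] by simp
    qed
    thus "inv\<^bsub>L\<^esub> x \<in> {x \<in> carrier L. \<forall>\<theta>\<in>carrier (aut_group L K). \<theta> x = x}" using x field_Units by simp
  next
    fix x y assume x: "x \<in> ?Fix" and y: "y \<in> ?Fix"
    have "\<theta> (\<ominus>\<^bsub>L\<^esub> x) = \<ominus>\<^bsub>L\<^esub> x \<and> \<theta> (x \<otimes>\<^bsub>L\<^esub> y) = x \<otimes>\<^bsub>L\<^esub> y \<and> \<theta> (x \<oplus>\<^bsub>L\<^esub> y) = x \<oplus>\<^bsub>L\<^esub> y"
      if s: "\<theta> \<in> carrier (aut_group L K)" for \<theta>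
    proof -
      interpret s: ring_hom_ring L L \<theta> by (rule hom[OF s])
      have "\<theta> x = x" "\<theta> y = y" "x \<in> carrier L" "y \<in> carrier L" using x y s by blast+
      thus ?thesis by simp
    qed
    thus "\<ominus>\<^bsub>L\<^esub> x \<in> ?Fix" "x \<otimes>\<^bsub>L\<^esub> y \<in> ?Fix" "x \<oplus>\<^bsub>L\<^esub> y \<in> ?Fix"
      using x y by blast+
  qed (auto simp: aut_group_carrier ring_hom_one[of _ L L])
qed

text \<open>If \<open>x\<close> is fixed, each root \<open>y\<close> of its minimal polynomial over
  \<open>K\<close> is the image of \<open>x\<close> under some automorphism over \<open>K\<close>,
  so \<open>x\<close> is its only conjugate and purely inseparable over \<open>K\<close>.
  Conversely, an automorphism fixing a power of \<open>x\<close> with exponent a power of the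
  characteristic exponent fixes \<open>x\<close>, as this power map is injective.\<close>

lemma ins_closure_eq_fixed_field:
  assumes ac: "algebraic_closure L E" and K: "subfield K L" "E \<subseteq> K"
  shows "ins_closure L K = {x \<in> carrier L. \<forall>\<theta>\<in>carrier (aut_group L K). \<theta> x = x}" (is "_ = ?Fix")
  unfolding ins_closure_def
proof (rule Greatest_equality)
  interpret algebraic_closure L E by fact
  have KL: "K \<subseteq> carrier L" using subfieldE(3)[OF K(1)] .
  have "\<exists>n. x [^]\<^bsub>L\<^esub> (char_exponent L ^ n) \<in> K" if x: "x \<in> ?Fix" for x
  proof -
    have xL: "x \<in> carrier L" using x by simp
    have alg: "(algebraic over K) x" using algebraic_mono[OF K(2)] algebraic_extension[OF xL] .
    note irr = IrrE[OF K(1) xL alg]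
    have "y = x" if y: "y \<in> carrier L" "eval (Irr K x) y = \<zero>\<^bsub>L\<^esub>" for y
    proof -
      have id: "(\<lambda>x. x) \<in> ring_hom (L\<lparr>carrier := K\<rparr>) L"
        using KL by (auto simp: ring_hom_def)
      have N: "subfield (simple_extension K x) L"
        using simple_extension_is_subfield[OF K(1) xL] alg by simp
      obtain h where h: "h \<in> ring_hom (L\<lparr>carrier := simple_extension K x\<rparr>) L"
        "\<And>a. a \<in> K \<Longrightarrow> h a = a" "h x = y"
        using simple_extension_hom[OF field_axioms field_axioms K(1) id xL _ y(1)] alg y(2)
        by (auto simp: over_def)
      obtain \<theta> where \<theta>: "\<theta> \<in> carrier (aut_group L K)" "\<And>a. a \<in> simple_extension K x \<Longrightarrow> \<theta> a = h a"
        using aut_group_extends_hom[OF ac K(2) simple_extension_incl[OF KL xL] N h(1,2)] by blast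
      have "\<theta> x = y" using \<theta>(2) simple_extension_mem[OF subfieldE(1)[OF K(1)] xL] h(3) by simp
      moreover have "\<theta> x = x" using x \<theta>(1) by blast
      ultimately show "y = x" by simp
    qed
    thus ?thesis using single_conjugate_imp_purely_inseparable[OF K(1) xL alg] by blast
  qed
  thus "purely_inseparable L K ?Fix"
    using fixed_field_subfield[OF field_axioms KL] KL
    by (auto simp: purely_inseparable_def subexts_def aut_group_carrier)
next
  interpret algebraic_closure L E by fact
  fix M assume M: "purely_inseparable L K M"
  show "M \<subseteq> ?Fix"
  proof (rule subsetI, rule CollectI, intro conjI ballI)
    fix x assume x: "x \<in> M"
    show xL: "x \<in> carrier L" using x M subfieldE(3) by (auto simp: purely_inseparable_def subexts_def)
    fix \<theta> assume \<theta>: "\<theta> \<in> carrier (aut_group L K)"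
    interpret s: ring_hom_ring L L \<theta>
      using \<theta> ring_hom_ringI2[OF ring_axioms ring_axioms] by (auto simp: aut_group_carrier)
    obtain n :: nat where n: "x [^]\<^bsub>L\<^esub> (char_exponent L ^ n) \<in> K" using M x by (auto simp: purely_inseparable_def)
    have "\<theta> x [^]\<^bsub>L\<^esub> (char_exponent L ^ n) = \<theta> (x [^]\<^bsub>L\<^esub> (char_exponent L ^ n))"
      using s.hom_nat_pow[OF xL] by simp
    also have "\<dots> = x [^]\<^bsub>L\<^esub> (char_exponent L ^ n)" using n \<theta> by (simp add: aut_group_carrier)
    finally show "\<theta> x = x" by (rule frobenius_pow_inj[rotated 2]) (auto simp: xL)
  qed
qed

subsection \<open>Homomorphisms from subextensions\<close>

lemma ring_hom_restrict_carrier: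
  "h \<in> ring_hom (R\<lparr>carrier := N\<rparr>) S \<Longrightarrow> M \<subseteq> N \<Longrightarrow> h \<in> ring_hom (R\<lparr>carrier := M\<rparr>) S"
  unfolding ring_hom_def subset_iff by auto

locale algebraic_ext =
  L: algebraic_closure L E + F: field F
  for L :: "('a, 'm) ring_scheme" and E :: "'a set" and F :: "('b, 'n) ring_scheme" +
  fixes \<iota> :: "'a \<Rightarrow> 'b"
  assumes embedding: "\<iota> \<in> ring_hom (L\<lparr>carrier := E\<rparr>) F"
    and algebraic_over_base: "x \<in> carrier F \<Longrightarrow> F.algebraic (\<iota> ` E) x"
begin

abbreviation Homs :: "'b set \<Rightarrow> ('b \<Rightarrow> 'a) set" where
  "Homs M \<equiv> ext_homs E \<iota> (F\<lparr>carrier := M\<rparr>) L"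

lemma base_subfield: "subfield (\<iota> ` E) F"
proof -
  have fE: "field (L\<lparr>carrier := E\<rparr>)" using L.subfield_iff(2)[OF L.subfield_axioms] .
  interpret i: ring_hom_ring "L\<lparr>carrier := E\<rparr>" F \<iota>
    using ring_hom_ringI2[OF field.is_ring[OF fE] F.ring_axioms embedding] .
  show ?thesis
    using i.img_is_subfield(2)[OF field.carrier_is_subfield[OF fE] F.one_not_zero] by simp
qed

lemma subextsD:
  assumes "M \<in> subexts F (\<iota> ` E)"
  shows "subfield M F" "\<iota> ` E \<subseteq> M" "M \<subseteq> carrier F" "field (F\<lparr>carrier := M\<rparr>)" "subring M F"
  using assms subfieldE(1,3)[of M F] F.subfield_iff(2)[of M] by (auto simp: subexts_def)

lemma carrier_in_subexts: "carrier F \<in> subexts F (\<iota> ` E)"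
  using F.carrier_is_subfield subfieldE(3)[OF base_subfield] by (simp add: subexts_def)

lemma HomsD:
  assumes "\<phi> \<in> Homs M"
  shows "\<phi> \<in> ring_hom (F\<lparr>carrier := M\<rparr>) L" "\<phi> \<in> extensional M" "\<And>e. e \<in> E \<Longrightarrow> \<phi> (\<iota> e) = e"
    "\<And>x. x \<in> M \<Longrightarrow> \<phi> x \<in> carrier L"
  using assms by (auto simp: ext_homs_def dest: ring_hom_memE(1))

lemma Homs_hom_ring:
  assumes "M \<in> subexts F (\<iota> ` E)" "\<phi> \<in> Homs M"
  shows "ring_hom_ring (F\<lparr>carrier := M\<rparr>) L \<phi>"
  using ring_hom_ringI2[OF field.is_ring[OF subextsD(4)[OF assms(1)]] L.ring_axioms HomsD(1)[OF assms(2)]] .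

lemma HomsI:
  assumes "M \<in> subexts F (\<iota> ` E)" "\<phi> \<in> ring_hom (F\<lparr>carrier := M\<rparr>) L" "\<And>e. e \<in> E \<Longrightarrow> \<phi> (\<iota> e) = e"
  shows "restrict \<phi> M \<in> Homs M"
  using assms subextsD(2)[OF assms(1)] F.subring_is_ring[OF subextsD(5)[OF assms(1)], THEN ring.ring_simprules(1)]
    subringE(3,6,7)[OF subextsD(5)[OF assms(1)]]
  by (auto simp: ext_homs_def ring_hom_def image_subset_iff)

lemma restrict_Homs:
  assumes "M \<in> subexts F (\<iota> ` E)" "M \<subseteq> N" "\<phi> \<in> Homs N"
  shows "restrict \<phi> M \<in> Homs M"
  by (rule HomsI[OF assms(1) ring_hom_restrict_carrier[OF HomsD(1)[OF assms(3)] assms(2)] HomsD(3)[OF assms(3)]])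

text \<open>Surjectivity of restriction: \<open>F\<close> is algebraic over \<open>M\<close>, so
  \<tau> extends to all of \<open>F\<close> and is then cut down to \<open>N\<close>.\<close>

lemma extend_Homs:
  assumes M: "M \<in> subexts F (\<iota> ` E)" and N: "N \<in> subexts F (\<iota> ` E)" "M \<subseteq> N" and \<tau>: "\<tau> \<in> Homs M"
  obtains \<phi> where "\<phi> \<in> Homs N" "restrict \<phi> M = \<tau>"
proof -
  have alg: "F.algebraic M x" if "x \<in> carrier F" for x
    using F.algebraic_mono[OF subextsD(2)[OF M]] algebraic_over_base[OF that] by (simp add: over_def)
  obtain h where h: "h \<in> ring_hom F L" "\<And>a. a \<in> M \<Longrightarrow> h a = \<tau> a"
    using hom_extends_to_algebraic_extension[OF F.field_axioms L.algebraically_closed_axioms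
        subextsD(1)[OF M] alg HomsD(1)[OF \<tau>]] by blast
  have hN: "h \<in> ring_hom (F\<lparr>carrier := N\<rparr>) L"
    by (rule ring_hom_restrict_carrier[where N = "carrier F"]) (use h(1) subextsD(3)[OF N(1)] in auto)
  have "h (\<iota> e) = e" if "e \<in> E" for e using h(2) HomsD(3)[OF \<tau> that] subextsD(2)[OF M] that by auto
  hence "restrict h N \<in> Homs N" by (rule HomsI[OF N(1) hN])
  moreover have "restrict (restrict h N) M = \<tau>"
    using h(2) N(2) HomsD(2)[OF \<tau>] by (auto simp: fun_eq_iff extensional_def)
  ultimately show thesis using that by blast
qed

text \<open>Since \<tau> is injective, \<tau>' after its inverse is a homomorphism over
  \<open>E\<close> from the image of \<tau> to \<open>L\<close>, and it extends to an automorphism.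
  This is the transitivity that makes all fibres of restriction equally large.\<close>

lemma Homs_conjugate:
  assumes M: "M \<in> subexts F (\<iota> ` E)" and \<tau>: "\<tau> \<in> Homs M" "\<tau>' \<in> Homs M"
  obtains \<theta> where "\<theta> \<in> carrier (aut_group L E)" "\<And>x. x \<in> M \<Longrightarrow> \<theta> (\<tau> x) = \<tau>' x"
proof -
  interpret FM: field "F\<lparr>carrier := M\<rparr>" by (rule subextsD(4)[OF M])
  interpret t: ring_hom_ring "F\<lparr>carrier := M\<rparr>" L \<tau> by (rule Homs_hom_ring[OF M \<tau>(1)])
  interpret t': ring_hom_ring "F\<lparr>carrier := M\<rparr>" L \<tau>' by (rule Homs_hom_ring[OF M \<tau>(2)])
  have cM: "subfield M (F\<lparr>carrier := M\<rparr>)" using FM.carrier_is_subfield by simp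
  note img = t.img_is_subfield[OF cM L.one_not_zero]
  interpret i: ring_hom_ring "L\<lparr>carrier := \<tau> ` M\<rparr>" "F\<lparr>carrier := M\<rparr>" "inv_into M \<tau>"
    by (rule t.inv_ring_hom[OF img(1) subfieldE(1)[OF cM]])
  define g where "g = \<tau>' \<circ> inv_into M \<tau>"
  have g: "g \<in> ring_hom (L\<lparr>carrier := \<tau> ` M\<rparr>) L"
    unfolding g_def by (rule ring_hom_trans[OF i.homh t'.homh])
  have gt: "g (\<tau> x) = \<tau>' x" if "x \<in> M" for x
    using that img(1) by (simp add: g_def)
  have iE: "\<iota> e \<in> M" if "e \<in> E" for e using that subextsD(2)[OF M] by blast
  have gE: "g e = e" if "e \<in> E" for e
    using gt[OF iE[OF that]] HomsD(3)[OF \<tau>(1) that] HomsD(3)[OF \<tau>(2) that] by simp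
  have "E \<subseteq> \<tau> ` M"
  proof
    fix e assume "e \<in> E"
    thus "e \<in> \<tau> ` M" using HomsD(3)[OF \<tau>(1)] iE by (metis imageI)
  qed
  then obtain \<theta> where "\<theta> \<in> carrier (aut_group L E)" "\<And>x. x \<in> \<tau> ` M \<Longrightarrow> \<theta> x = g x"
    using aut_group_extends_hom[OF L.algebraic_closure_axioms subset_refl _ img(2) g gE] by blast
  thus thesis using that[of \<theta>] gt by simp
qed

text \<open>The set where both homomorphisms agree is an additive group containing all products of
  base elements with members of \<open>Us\<close>, hence their span. Homomorphisms from a finite
  subextension are thus controlled by finitely many values.\<close>

lemma Homs_eqI:
  assumes M: "M \<in> subexts F (\<iota> ` E)" and span: "M = F.Span (\<iota> ` E) Us" "set Us \<subseteq> carrier F"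
    and \<phi>: "\<phi> \<in> Homs M" "\<psi> \<in> Homs M" and eq: "\<And>u. u \<in> set Us \<Longrightarrow> \<phi> u = \<psi> u"
  shows "\<phi> = \<psi>"
proof -
  interpret p: ring_hom_ring "F\<lparr>carrier := M\<rparr>" L \<phi> by (rule Homs_hom_ring[OF M \<phi>(1)])
  interpret q: ring_hom_ring "F\<lparr>carrier := M\<rparr>" L \<psi> by (rule Homs_hom_ring[OF M \<phi>(2)])
  note sM = subringE[OF subextsD(5)[OF M]]
  define A where "A = {x \<in> M. \<phi> x = \<psi> x}"
  have neg: "\<phi> (\<ominus>\<^bsub>F\<^esub> x) = \<ominus>\<^bsub>L\<^esub> \<phi> x" "\<psi> (\<ominus>\<^bsub>F\<^esub> x) = \<ominus>\<^bsub>L\<^esub> \<psi> x" if "x \<in> M" for x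
    using p.hom_a_inv[of x] q.hom_a_inv[of x] that F.a_inv_subring[OF subextsD(5)[OF M] that] by simp_all
  have "subring A F"
    by (rule F.subringI)
      (use sM neg p.hom_one q.hom_one p.hom_mult q.hom_mult p.hom_add q.hom_add in \<open>auto simp: A_def\<close>)
  hence sg: "subgroup A (add_monoid F)" by (rule subring.axioms(1))
  have UM: "set Us \<subseteq> M" using F.Span_base_incl[OF base_subfield span(2)] span(1) by simp
  have "\<iota> ` E <#>\<^bsub>F\<^esub> set Us \<subseteq> A"
  proof
    fix x assume "x \<in> \<iota> ` E <#>\<^bsub>F\<^esub> set Us"
    then obtain e u where eu: "e \<in> E" "u \<in> set Us" "x = \<iota> e \<otimes>\<^bsub>F\<^esub> u" by (auto simp: set_mult_def)
    have m: "\<iota> e \<in> M" "u \<in> M" using eu subextsD(2)[OF M] UM by auto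
    have "\<phi> x = \<psi> x"
      using p.hom_mult[of "\<iota> e" u] q.hom_mult[of "\<iota> e" u] m eu eq HomsD(3)[OF \<phi>(1) eu(1)] HomsD(3)[OF \<phi>(2) eu(1)]
      by simp
    thus "x \<in> A" using sM(6)[OF m] eu(3) by (simp add: A_def)
  qed
  hence "M \<subseteq> A" using F.Span_min[OF base_subfield span(2) sg] span(1) by simp
  thus ?thesis using HomsD(2)[OF \<phi>(1)] HomsD(2)[OF \<phi>(2)] by (intro extensionalityI) (auto simp: A_def)
qed

text \<open>Each member of a finite spanning list is a root of a nonzero polynomial over the base,
  so its image ranges over a finite root set in \<open>L\<close>. Restriction to the list embeds the
  homomorphisms into the finite product of these sets.\<close>

lemma finite_Homs:
  assumes M: "M \<in> fin_subexts F (\<iota> ` E)"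
  shows "finite (Homs M)"
proof (cases "Homs M = {}")
  case False
  then obtain \<phi>\<^sub>0 where \<phi>\<^sub>0: "\<phi>\<^sub>0 \<in> Homs M" by blast
  have Ms: "M \<in> subexts F (\<iota> ` E)" using M by (simp add: fin_subexts_def)
  have "F.finite_dimension (\<iota> ` E) M" using M by (simp add: fin_subexts_def)
  then obtain n where "F.dimension n (\<iota> ` E) M" by (auto simp: F.finite_dimension_def)
  from F.exists_base[OF base_subfield this]
  obtain Us where Us: "set Us \<subseteq> carrier F" "M = F.Span (\<iota> ` E) Us" by blast
  have UM: "set Us \<subseteq> M" using F.Span_base_incl[OF base_subfield Us(1)] Us(2) by simp
  have "\<exists>p. p \<in> carrier (univ_poly F (\<iota> ` E)) \<and> p \<noteq> [] \<and> F.eval p u = \<zero>\<^bsub>F\<^esub>" if "u \<in> set Us" for u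
    using F.algebraicE[OF subfieldE(1)[OF base_subfield], of u] algebraic_over_base Us(1) that
    by (metis over_def subsetD)
  then obtain P where P: "\<And>u. u \<in> set Us \<Longrightarrow> P u \<in> carrier (univ_poly F (\<iota> ` E))"
    "\<And>u. u \<in> set Us \<Longrightarrow> P u \<noteq> []" "\<And>u. u \<in> set Us \<Longrightarrow> F.eval (P u) u = \<zero>\<^bsub>F\<^esub>" by metis
  have PM: "P u \<in> carrier (poly_ring (F\<lparr>carrier := M\<rparr>))" if "u \<in> set Us" for u
  proof -
    have "P u \<in> carrier (univ_poly F M)"
      using P(1)[OF that] subextsD(2)[OF Ms] unfolding univ_poly_def polynomial_def by auto
    thus ?thesis using F.univ_poly_consistent[OF subextsD(5)[OF Ms]] by simp
  qed
  \<comment> \<open>The homomorphism \<open>\<phi>\<^sub>0\<close> only transports coefficients to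
    \<open>L\<close>. They come from the base field, so every other homomorphism transports them in
    the same way.\<close>
  define R where "R = (\<lambda>u. {z. L.is_root (map \<phi>\<^sub>0 (P u)) z})"
  have fin: "finite (R u)" if "u \<in> set Us" for u
    unfolding R_def
    by (rule L.finite_number_of_roots[OF polynomial_hom[OF HomsD(1)[OF \<phi>\<^sub>0] subextsD(4)[OF Ms] L.field_axioms PM[OF that]]])
  have "restrict \<phi> (set Us) \<in> Pi\<^sub>E (set Us) R" if \<phi>: "\<phi> \<in> Homs M" for \<phi>
  proof (rule restrict_PiE_iff[THEN iffD2], rule ballI)
    fix u assume u: "u \<in> set Us"
    interpret p: ring_hom_ring "F\<lparr>carrier := M\<rparr>" L \<phi> by (rule Homs_hom_ring[OF Ms \<phi>])
    have "set (P u) \<subseteq> \<iota> ` E" using P(1)[OF u] F.polynomial_incl univ_poly_carrier by blast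
    hence map_eq: "map \<phi>\<^sub>0 (P u) = map \<phi> (P u)" using HomsD(3)[OF \<phi>] HomsD(3)[OF \<phi>\<^sub>0] by auto
    have uM: "u \<in> M" using u UM by blast
    have "set (P u) \<subseteq> M" using \<open>set (P u) \<subseteq> \<iota> ` E\<close> subextsD(2)[OF Ms] by blast
    hence "L.eval (map \<phi> (P u)) (\<phi> u) = \<phi> (F.eval (P u) u)"
      using p.eval_hom'[of u "P u"] uM F.eval_consistent[OF subextsD(5)[OF Ms]] by simp
    also have "\<dots> = \<zero>\<^bsub>L\<^esub>" using P(3)[OF u] p.hom_zero by simp
    finally show "\<phi> u \<in> R u"
      using HomsD(4)[OF \<phi> uM] P(2)[OF u] by (simp add: R_def L.is_root_def map_eq)
  qed
  hence "(\<lambda>\<phi>. restrict \<phi> (set Us)) ` Homs M \<subseteq> Pi\<^sub>E (set Us) R" by blast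
  moreover have "finite (Pi\<^sub>E (set Us) R)" using fin by (intro finite_PiE) auto
  ultimately have "finite ((\<lambda>\<phi>. restrict \<phi> (set Us)) ` Homs M)" by (rule finite_subset)
  moreover have "inj_on (\<lambda>\<phi>. restrict \<phi> (set Us)) (Homs M)"
  proof (rule inj_onI)
    fix \<phi> \<psi> assume \<phi>: "\<phi> \<in> Homs M" "\<psi> \<in> Homs M" "restrict \<phi> (set Us) = restrict \<psi> (set Us)"
    show "\<phi> = \<psi>" by (rule Homs_eqI[OF Ms Us(2,1) \<phi>(1,2)]) (metis \<phi>(3) restrict_apply')
  qed
  ultimately show ?thesis by (rule finite_imageD)
qed simp

end

subsection \<open>The action on the fibres of restriction\<close>

text \<open>Bijectivity of each map comes from the action of the inverse element; the maps are
  restricted to \<open>Y\<close> because members of \<open>BijGroup Y\<close> are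
  extensional.\<close>

lemma group_actionI:
  assumes "group G"
    and closed: "\<And>g y. g \<in> carrier G \<Longrightarrow> y \<in> Y \<Longrightarrow> f g y \<in> Y"
    and one: "\<And>y. y \<in> Y \<Longrightarrow> f \<one>\<^bsub>G\<^esub> y = y"
    and mult: "\<And>g h y. g \<in> carrier G \<Longrightarrow> h \<in> carrier G \<Longrightarrow> y \<in> Y \<Longrightarrow> f (g \<otimes>\<^bsub>G\<^esub> h) y = f g (f h y)"
  shows "group_action G Y (\<lambda>g. \<lambda>y\<in>Y. f g y)"
proof -
  interpret group G by fact
  have bij: "(\<lambda>y\<in>Y. f g y) \<in> Bij Y" if g: "g \<in> carrier G" for g
  proof -
    have "bij_betw (f g) Y Y"
    proof (rule bij_betw_byWitness[where f' = "f (inv\<^bsub>G\<^esub> g)"])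
      show "\<forall>a\<in>Y. f (inv\<^bsub>G\<^esub> g) (f g a) = a" "\<forall>a\<in>Y. f g (f (inv\<^bsub>G\<^esub> g) a) = a"
        using g mult[symmetric] one by simp_all
    qed (use closed g in auto)
    thus ?thesis by (simp add: Bij_def cong: bij_betw_cong)
  qed
  have "(\<lambda>g. \<lambda>y\<in>Y. f g y) \<in> hom G (BijGroup Y)"
    using bij mult closed
    by (auto simp: hom_def BijGroup_def compose_def fun_eq_iff restrict_def)
  thus ?thesis
    unfolding group_action_def group_hom_def group_hom_axioms_def
    using \<open>group G\<close> group_BijGroup by blast
qed

text \<open>Fixing \<open>K\<close> and \<open>S\<close> pointwise means fixing the field generated
  by them, which is finite over \<open>K\<close> because \<open>S\<close> is finite and algebraic.
  The stabilizer is thus the automorphism group over a finite subextension, a generating open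
  set.\<close>

lemma openin_krull_pointwise_stabilizer:
  assumes "field L" and K: "subfield K L" and grp: "group (aut_group L K)"
    and S: "finite S" "S \<subseteq> carrier L" and alg: "\<And>x. x \<in> S \<Longrightarrow> ring.algebraic L K x"
  shows "openin (krull_topology L K) {\<theta> \<in> carrier (aut_group L K). \<forall>x\<in>S. \<theta> x = x}" (is "openin _ ?H")
proof -
  interpret L: field L by fact
  interpret G: group "aut_group L K" by fact
  obtain xs where xs: "set xs = S" using finite_list[OF S(1)] by blast
  define M where "M = L.finite_extension K xs"
  have alg': "(L.algebraic over K) x" if "x \<in> set xs" for x using alg that xs by (simp add: over_def)
  have xsL: "set xs \<subseteq> carrier L" using xs S by simp
  have KM: "K \<subseteq> M" unfolding M_def by (rule L.finite_extension_incl[OF subfieldE(3)[OF K] xsL])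
  have SM: "S \<subseteq> M" using L.finite_extension_mem[OF subfieldE(1)[OF K] xsL] xs by (simp only: M_def)
  have "M \<in> fin_subexts L K"
    using L.finite_extension_is_subfield[OF K xsL alg'] L.finite_extension_finite_dimension(1)[OF K xsL alg'] KM
    by (simp only: fin_subexts_def subexts_def M_def mem_Collect_eq)
  moreover have "carrier (aut_group L M) = ?H"
  proof
    show "carrier (aut_group L M) \<subseteq> ?H" using KM SM by (auto simp: aut_group_carrier)
    show "?H \<subseteq> carrier (aut_group L M)"
    proof
      fix \<theta> assume "\<theta> \<in> ?H"
      hence \<theta>: "\<theta> \<in> ring_hom L L" "\<theta> \<in> Bij (carrier L)" "\<And>x. x \<in> K \<Longrightarrow> \<theta> x = x" "\<And>x. x \<in> S \<Longrightarrow> \<theta> x = x"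
        by (auto simp: aut_group_carrier)
      interpret s: ring_hom_ring L L \<theta> by (rule ring_hom_ringI2[OF L.ring_axioms L.ring_axioms \<theta>(1)])
      have "subring {x \<in> carrier L. \<theta> x = x} L" by (rule L.subringI) auto
      hence "M \<subseteq> {x \<in> carrier L. \<theta> x = x}"
        unfolding M_def by (rule L.finite_extension_subring_incl) (use \<theta> xs S subfieldE(3)[OF K] in auto)
      thus "\<theta> \<in> carrier (aut_group L M)" using \<theta> by (auto simp: aut_group_carrier)
    qed
  qed
  \<comment> \<open>The topology is generated by cosets, so the subgroup has to be presented as the
    coset of the unit.\<close>
  moreover have "\<one>\<^bsub>aut_group L K\<^esub> <#\<^bsub>aut_group L K\<^esub> ?H = ?H"
    by (auto simp: l_coset_def)
  ultimately have "?H \<in> {\<theta> <#\<^bsub>aut_group L K\<^esub> carrier (aut_group L M) | \<theta> M.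
      \<theta> \<in> carrier (aut_group L K) \<and> M \<in> fin_subexts L K}"
    using G.one_closed by (metis (mono_tags, lifting) mem_Collect_eq)
  thus ?thesis unfolding krull_topology_def by (rule topology_generated_by_Basis)
qed

section \<open>Sizes of the fibres of restriction, and a fixed point in each fibre\<close>

context algebraic_ext
begin

lemma compose_Homs:
  assumes N: "N \<in> subexts F (\<iota> ` E)" and \<theta>: "\<theta> \<in> carrier (aut_group L E)" and \<phi>: "\<phi> \<in> Homs N"
  shows "compose N \<theta> \<phi> \<in> Homs N"
proof -
  have "\<theta> \<circ> \<phi> \<in> ring_hom (F\<lparr>carrier := N\<rparr>) L"
    using ring_hom_trans[OF HomsD(1)[OF \<phi>]] \<theta> by (auto simp: aut_group_carrier)
  moreover have "(\<theta> \<circ> \<phi>) (\<iota> e) = e" if "e \<in> E" for e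
    using HomsD(3)[OF \<phi> that] \<theta> that by (simp add: aut_group_carrier)
  ultimately have "restrict (\<theta> \<circ> \<phi>) N \<in> Homs N" by (rule HomsI[OF N])
  thus ?thesis by (simp add: compose_def comp_def)
qed

text \<open>Composition with an automorphism carrying \<tau> to \<tau>' embeds one fibre into the
  other. Exchanging \<tau> and \<tau>' turns the inequality into an equality.\<close>

lemma card_fibre_le:
  assumes M: "M \<in> fin_subexts F (\<iota> ` E)" and N: "N \<in> fin_subexts F (\<iota> ` E)" and MN: "M \<subseteq> N"
    and \<tau>: "\<tau> \<in> Homs M" "\<tau>' \<in> Homs M"
  shows "card {\<phi> \<in> Homs N. restrict \<phi> M = \<tau>} \<le> card {\<phi> \<in> Homs N. restrict \<phi> M = \<tau>'}"
proof -
  have Ms: "M \<in> subexts F (\<iota> ` E)" and Ns: "N \<in> subexts F (\<iota> ` E)"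
    using M N by (auto simp: fin_subexts_def)
  obtain \<theta> where \<theta>: "\<theta> \<in> carrier (aut_group L E)" "\<And>x. x \<in> M \<Longrightarrow> \<theta> (\<tau> x) = \<tau>' x"
    using Homs_conjugate[OF Ms \<tau>] by blast
  have inj: "inj_on \<theta> (carrier L)" using \<theta>(1) by (simp add: aut_group_carrier Bij_def bij_betw_def)
  show ?thesis
  proof (rule card_inj_on_le[where f = "compose N \<theta>"])
    show "inj_on (compose N \<theta>) {\<phi> \<in> Homs N. restrict \<phi> M = \<tau>}"
    proof (rule inj_onI)
      fix \<phi> \<psi> assume "\<phi> \<in> {\<phi> \<in> Homs N. restrict \<phi> M = \<tau>}" "\<psi> \<in> {\<phi> \<in> Homs N. restrict \<phi> M = \<tau>}"
        and eq: "compose N \<theta> \<phi> = compose N \<theta> \<psi>"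
      hence h: "\<phi> \<in> Homs N" "\<psi> \<in> Homs N" by auto
      have "\<phi> x = \<psi> x" if "x \<in> N" for x
        using fun_cong[OF eq, of x] that inj_onD[OF inj] HomsD(4)[OF h(1) that] HomsD(4)[OF h(2) that]
        by (simp add: compose_def)
      thus "\<phi> = \<psi>" using HomsD(2)[OF h(1)] HomsD(2)[OF h(2)] by (intro extensionalityI)
    qed
    show "compose N \<theta> ` {\<phi> \<in> Homs N. restrict \<phi> M = \<tau>} \<subseteq> {\<phi> \<in> Homs N. restrict \<phi> M = \<tau>'}"
    proof
      fix \<psi> assume "\<psi> \<in> compose N \<theta> ` {\<phi> \<in> Homs N. restrict \<phi> M = \<tau>}"
      then obtain \<phi> where \<phi>: "\<phi> \<in> Homs N" "restrict \<phi> M = \<tau>" "\<psi> = compose N \<theta> \<phi>" by blast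
      have "restrict \<psi> M x = \<tau>' x" for x
      proof (cases "x \<in> M")
        case True
        have "\<phi> x = \<tau> x" using True fun_cong[OF \<phi>(2), of x] by simp
        thus ?thesis using True MN \<theta>(2) by (auto simp: \<phi>(3) compose_def)
      next
        case False
        thus ?thesis using HomsD(2)[OF \<tau>(2)] by (simp add: extensional_def)
      qed
      thus "\<psi> \<in> {\<phi> \<in> Homs N. restrict \<phi> M = \<tau>'}"
        using compose_Homs[OF Ns \<theta>(1) \<phi>(1)] \<phi>(3) by auto
    qed
    show "finite {\<phi> \<in> Homs N. restrict \<phi> M = \<tau>'}" using finite_Homs[OF N] by simp
  qed
qed

text \<open>\<open>Homs N\<close> is the disjoint union of its fibres over \<open>Homs M\<close>,
  all of the same size. In particular the size of a fibre divides the cardinality of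
  \<open>Homs N\<close>.\<close>

lemma card_Homs_mult:
  assumes M: "M \<in> fin_subexts F (\<iota> ` E)" and N: "N \<in> fin_subexts F (\<iota> ` E)" and MN: "M \<subseteq> N"
    and \<tau>: "\<tau> \<in> Homs M"
  shows "card (Homs N) = card (Homs M) * card {\<phi> \<in> Homs N. restrict \<phi> M = \<tau>}"
proof -
  let ?B = "\<lambda>\<tau>. {\<phi> \<in> Homs N. restrict \<phi> M = \<tau>}"
  have Ms: "M \<in> subexts F (\<iota> ` E)" using M by (auto simp: fin_subexts_def)
  have "Homs N = (\<Union>\<tau>\<in>Homs M. ?B \<tau>)" using restrict_Homs[OF Ms MN] by auto
  hence "card (Homs N) = card (\<Union>\<tau>\<in>Homs M. ?B \<tau>)" by (rule arg_cong)
  also have "\<dots> = (\<Sum>\<tau>'\<in>Homs M. card (?B \<tau>'))"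
    using finite_Homs[OF M] finite_Homs[OF N] by (subst card_UN_disjoint) auto
  also have "\<dots> = (\<Sum>\<tau>'\<in>Homs M. card (?B \<tau>))"
    by (intro sum.cong refl antisym card_fibre_le[OF M N MN] \<tau>)
  finally show ?thesis by simp
qed

text \<open>The inequality holds because restriction to \<open>M\<close>, applied to
  \<open>H\<close>, reaches every element of \<open>Homs M\<close>.\<close>

theorem card_Homs_le_card_ins_closure_homs:
  assumes K: "subfield K L" "E \<subseteq> K" and p: "Factorial_Ring.prime p"
    and pro: "pro_p_group p (aut_group L K) (krull_topology L K)"
    and M: "M \<in> fin_subexts F (\<iota> ` E)" and N: "N \<in> fin_subexts F (\<iota> ` E)" and MN: "M \<subseteq> N"
    and nd: "\<not> p dvd card (Homs N)"
    and tot: "\<And>\<tau>. \<tau> \<in> Homs M \<Longrightarrow> \<tau> ` M \<subseteq> K"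
  defines "H \<equiv> ext_homs E \<iota> (F\<lparr>carrier := N\<rparr>) (L\<lparr>carrier := ins_closure L K\<rparr>)"
  shows "finite H" and "card (Homs M) \<le> card H"
proof -
  have Ms: "M \<in> subexts F (\<iota> ` E)" and Ns: "N \<in> subexts F (\<iota> ` E)"
    using M N by (auto simp: fin_subexts_def)
  have grp: "group (aut_group L K)"
    using pro by (simp add: pro_p_group_def profinite_group_def topological_group_def)
  interpret G: group "aut_group L K" by (rule grp)
  note ins = ins_closure_eq_fixed_field[OF L.algebraic_closure_axioms K]
  have HH: "H \<subseteq> Homs N" unfolding H_def ins by (auto simp: ext_homs_def ring_hom_def)
  thus fin: "finite H" using finite_Homs[OF N] finite_subset by blast
  have autKE: "\<theta> \<in> carrier (aut_group L E)" if "\<theta> \<in> carrier (aut_group L K)" for \<theta>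
    using that K(2) by (auto simp: aut_group_carrier)
  obtain Us where Us: "set Us \<subseteq> carrier F" "N = F.Span (\<iota> ` E) Us"
  proof -
    have "F.finite_dimension (\<iota> ` E) N" using N by (simp add: fin_subexts_def)
    then obtain n where "F.dimension n (\<iota> ` E) N" by (auto simp: F.finite_dimension_def)
    from F.exists_base[OF base_subfield this] show ?thesis using that by blast
  qed
  have UN: "set Us \<subseteq> N" using F.Span_base_incl[OF base_subfield Us(1)] Us(2) by simp
  have "\<exists>\<phi>\<in>H. restrict \<phi> M = \<tau>" if \<tau>: "\<tau> \<in> Homs M" for \<tau>
  proof -
    define Y where "Y = {\<phi> \<in> Homs N. restrict \<phi> M = \<tau>}"
    have finY: "finite Y" using finite_Homs[OF N] by (simp add: Y_def)
    have YN: "\<phi> \<in> Homs N" if "\<phi> \<in> Y" for \<phi> using that by (simp add: Y_def)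
    have ndY: "\<not> p dvd card Y"
      using nd card_Homs_mult[OF M N MN \<tau>] dvd_mult[of p "card Y" "card (Homs M)"] by (auto simp: Y_def)
    \<comment> \<open>The values of \<tau> lie in \<open>K\<close>, so composing with an
      automorphism over \<open>K\<close> does not leave the fibre \<open>Y\<close>.\<close>
    have \<tau>K: "\<theta> (\<tau> x) = \<tau> x" if "\<theta> \<in> carrier (aut_group L K)" "x \<in> M" for \<theta> x
      using tot[OF \<tau>] that by (auto simp: aut_group_carrier)
    have act: "group_action (aut_group L K) Y (\<lambda>\<theta>. \<lambda>\<phi>\<in>Y. compose N \<theta> \<phi>)"
    proof (rule group_actionI[OF grp])
      fix \<theta> \<phi> assume \<theta>: "\<theta> \<in> carrier (aut_group L K)" and \<phi>: "\<phi> \<in> Y"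
      have "restrict (compose N \<theta> \<phi>) M x = \<tau> x" for x
      proof (cases "x \<in> M")
        case True
        have "\<phi> x = \<tau> x" using True \<phi> by (auto simp: Y_def)
        thus ?thesis using True MN \<tau>K[OF \<theta>] by (auto simp: compose_def)
      next
        case False
        thus ?thesis using HomsD(2)[OF \<tau>] by (simp add: extensional_def)
      qed
      thus "compose N \<theta> \<phi> \<in> Y" using compose_Homs[OF Ns autKE[OF \<theta>] YN[OF \<phi>]] by (auto simp: Y_def)
    next
      fix \<phi> assume \<phi>: "\<phi> \<in> Y"
      show "compose N \<one>\<^bsub>aut_group L K\<^esub> \<phi> = \<phi>"
        using HomsD(2,4)[OF YN[OF \<phi>]]
        by (auto simp: aut_group_one compose_def fun_eq_iff extensional_def)
    next
      fix \<theta> \<theta>' \<phi> assume \<theta>: "\<theta> \<in> carrier (aut_group L K)" "\<theta>' \<in> carrier (aut_group L K)" and \<phi>: "\<phi> \<in> Y"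
      show "compose N (\<theta> \<otimes>\<^bsub>aut_group L K\<^esub> \<theta>') \<phi> = compose N \<theta> (compose N \<theta>' \<phi>)"
        using HomsD(4)[OF YN[OF \<phi>]] by (auto simp: compose_def fun_eq_iff aut_group_apply[OF \<theta>])
    qed
    \<comment> \<open>An automorphism acts trivially on \<open>Y\<close> exactly when it fixes the
      values of all members of \<open>Y\<close> on the spanning list. These finitely many values
      form \<open>S\<close>, which makes the kernel of the action open.\<close>
    define S where "S = (\<Union>\<phi>\<in>Y. \<phi> ` set Us)"
    have SL: "S \<subseteq> carrier L" using HomsD(4)[OF YN] UN by (auto simp: S_def)
    have kernel: "{\<theta> \<in> carrier (aut_group L K). \<forall>\<phi>\<in>Y. (\<lambda>\<phi>\<in>Y. compose N \<theta> \<phi>) \<phi> = \<phi>}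
        = {\<theta> \<in> carrier (aut_group L K). \<forall>x\<in>S. \<theta> x = x}"
    proof -
      have "compose N \<theta> \<phi> = \<phi> \<longleftrightarrow> (\<forall>u\<in>set Us. \<theta> (\<phi> u) = \<phi> u)"
        if "\<theta> \<in> carrier (aut_group L K)" "\<phi> \<in> Y" for \<theta> \<phi>
      proof
        assume "compose N \<theta> \<phi> = \<phi>"
        thus "\<forall>u\<in>set Us. \<theta> (\<phi> u) = \<phi> u" using UN by (metis compose_eq subsetD)
      next
        assume "\<forall>u\<in>set Us. \<theta> (\<phi> u) = \<phi> u"
        thus "compose N \<theta> \<phi> = \<phi>"
          using UN compose_Homs[OF Ns autKE YN] YN that
          by (intro Homs_eqI[OF Ns Us(2,1)]) (auto simp: compose_eq)
      qed
      thus ?thesis by (auto simp: S_def)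
    qed
    have "openin (krull_topology L K)
        {\<theta> \<in> carrier (aut_group L K). \<forall>\<phi>\<in>Y. (\<lambda>\<phi>\<in>Y. compose N \<theta> \<phi>) \<phi> = \<phi>}"
      unfolding kernel
    proof (rule openin_krull_pointwise_stabilizer[OF L.field_axioms K(1) grp _ SL])
      show "finite S" using finY by (simp add: S_def)
      show "L.algebraic K x" if "x \<in> S" for x
        using L.algebraic_mono[OF K(2)] L.algebraic_extension that SL by (auto simp: over_def)
    qed
    then obtain \<phi> where \<phi>: "\<phi> \<in> Y" "\<And>\<theta>. \<theta> \<in> carrier (aut_group L K) \<Longrightarrow> (\<lambda>\<phi>\<in>Y. compose N \<theta> \<phi>) \<phi> = \<phi>"
      using pro_p_group_fixed_point[OF p pro act finY ndY] by blast
    have "\<theta> (\<phi> x) = \<phi> x" if "\<theta> \<in> carrier (aut_group L K)" "x \<in> N" for \<theta> x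
      using \<phi>(2)[OF that(1)] \<phi>(1) that(2) by (metis compose_eq restrict_apply')
    hence "\<phi> ` N \<subseteq> ins_closure L K" using HomsD(4)[OF YN[OF \<phi>(1)]] by (auto simp: ins)
    hence "\<phi> \<in> H" using YN[OF \<phi>(1)] by (auto simp: H_def ext_homs_def ring_hom_def)
    thus ?thesis using \<phi>(1) by (auto simp: Y_def)
  qed
  hence "Homs M \<subseteq> (\<lambda>\<phi>. restrict \<phi> M) ` H" by blast
  thus "card (Homs M) \<le> card H" using fin surj_card_le by blast
qed

end

subsection \<open>The greatest totally-\<open>K\<close> subextension and the limit inferior\<close>

text \<open>An infinite set has finite subsets of every size, so \<open>P\<close> exceeds all
  natural numbers and must be infinite. This reduces a possibly infinite separable degree to finite
  sets of homomorphisms.\<close>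

lemma ennreal_of_enat_ecard_le:
  assumes "\<And>A. finite A \<Longrightarrow> A \<subseteq> B \<Longrightarrow> of_nat (card A) \<le> (P::ennreal)"
  shows "ennreal_of_enat (ecard B) \<le> P"
proof (cases "finite B")
  case True
  thus ?thesis using assms[of B] by (simp add: ecard_def)
next
  case False
  have "of_nat n \<le> P" for n
  proof -
    obtain A where "finite A" "card A = n" "A \<subseteq> B" using infinite_arbitrarily_large[OF False] by blast
    thus ?thesis using assms by blast
  qed
  hence "\<not> P < Orderings.top" using ennreal_Ex_less_of_nat leD by blast
  hence "P = Orderings.top" using top.not_eq_extremum by blast
  thus ?thesis by simp
qed

text \<open>A limit point below \<open>c\<close> has the open ray below \<open>c\<close> as a
  neighborhood; by cofinality some value beyond \<open>i\<close> would lie in that ray.\<close>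

lemma le_dir_liminfI:
  assumes "i \<in> I" and "\<And>j. j \<in> I \<Longrightarrow> i \<le> j \<Longrightarrow> c \<le> f j"
  shows "c \<le> dir_liminf I f"
  unfolding dir_liminf_def
proof (rule Inf_greatest)
  fix P assume P: "P \<in> limit_points I f"
  show "c \<le> P"
  proof (rule ccontr)
    assume "\<not> c \<le> P"
    hence "open {..<c} \<and> P \<in> {..<c}" by simp
    hence "Defs.cofinal I {i \<in> I. f i \<in> {..<c}}" using P unfolding limit_points_def by blast
    then obtain j where "j \<in> I" "f j < c" "i \<le> j" using assms(1) by (auto simp: Defs.cofinal_def)
    thus False using assms(2) leD by blast
  qed
qed

section \<open>The greatest totally-\<open>K\<close> subextension and its finite parts\<close>

context algebraic_ext
begin

text \<open>The intersection of the preimages of \<open>K\<close> under all homomorphisms from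
  \<open>F\<close> is a subfield. It is totally-\<open>K\<close> because every homomorphism from it
  extends to \<open>F\<close>, and it contains every totally-\<open>K\<close> subextension because
  homomorphisms from \<open>F\<close> restrict.\<close>

lemma max_totally_eq:
  assumes K: "subfield K L" "E \<subseteq> K"
  shows "max_totally L E K \<iota> F = {x \<in> carrier F. \<forall>\<phi>\<in>Homs (carrier F). \<phi> x \<in> K}" (is "_ = ?M")
    and "max_totally L E K \<iota> F \<in> subexts F (\<iota> ` E)"
    and "totally L E K \<iota> (F\<lparr>carrier := max_totally L E K \<iota> F\<rparr>)"
proof -
  note sK = subringE[OF subfieldE(1)[OF K(1)]]
  have "subfield ?M F"
  proof (rule F.subfieldI'[OF F.subringI])
    fix x y assume x: "x \<in> ?M" and y: "y \<in> ?M"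
    have "\<phi> (\<ominus>\<^bsub>F\<^esub> x) \<in> K \<and> \<phi> (x \<otimes>\<^bsub>F\<^esub> y) \<in> K \<and> \<phi> (x \<oplus>\<^bsub>F\<^esub> y) \<in> K" if \<phi>: "\<phi> \<in> Homs (carrier F)" for \<phi>
    proof -
      interpret p: ring_hom_ring F L \<phi> using Homs_hom_ring[OF carrier_in_subexts \<phi>] by simp
      show ?thesis using x y \<phi> sK(5-7) by simp
    qed
    thus "\<ominus>\<^bsub>F\<^esub> x \<in> ?M" "x \<otimes>\<^bsub>F\<^esub> y \<in> ?M" "x \<oplus>\<^bsub>F\<^esub> y \<in> ?M" using x y by auto
  next
    have "\<phi> \<one>\<^bsub>F\<^esub> \<in> K" if \<phi>: "\<phi> \<in> Homs (carrier F)" for \<phi>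
      using ring_hom_one[OF HomsD(1)[OF \<phi>]] sK(3) by simp
    thus "\<one>\<^bsub>F\<^esub> \<in> ?M" by simp
  next
    fix x assume x: "x \<in> ?M - {\<zero>\<^bsub>F\<^esub>}"
    have xF: "x \<in> carrier F" "x \<in> Units F" using x by (auto simp: F.field_Units)
    have "\<phi> (inv\<^bsub>F\<^esub> x) \<in> K" if \<phi>: "\<phi> \<in> Homs (carrier F)" for \<phi>
    proof -
      interpret p: ring_hom_ring F L \<phi> using Homs_hom_ring[OF carrier_in_subexts \<phi>] by simp
      have 1: "\<phi> x \<otimes>\<^bsub>L\<^esub> \<phi> (inv\<^bsub>F\<^esub> x) = \<one>\<^bsub>L\<^esub>"
        using p.hom_mult[OF xF(1) F.Units_inv_closed[OF xF(2)]] F.Units_r_inv[OF xF(2)] p.hom_one by metis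
      have inv: "inv\<^bsub>L\<^esub> (\<phi> x) = \<phi> (inv\<^bsub>F\<^esub> x)"
        using L.comm_inv_char[OF _ _ 1] p.hom_closed xF F.Units_inv_closed by simp
      have "\<phi> x \<noteq> \<zero>\<^bsub>L\<^esub>" using 1 p.hom_closed xF F.Units_inv_closed by force
      moreover have "\<phi> x \<in> K" using x \<phi> by blast
      ultimately show ?thesis using L.subfield_m_inv(1)[OF K(1), of "\<phi> x"] inv by simp
    qed
    thus "inv\<^bsub>F\<^esub> x \<in> ?M" using xF by simp
  qed auto
  moreover have "\<phi> (\<iota> e) \<in> K" if "e \<in> E" "\<phi> \<in> Homs (carrier F)" for e \<phi>
    using HomsD(3)[OF that(2,1)] that(1) K(2) by auto
  ultimately have M: "?M \<in> subexts F (\<iota> ` E)"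
    using subextsD(2)[OF carrier_in_subexts] by (auto simp: subexts_def)
  have tot: "totally L E K \<iota> (F\<lparr>carrier := ?M\<rparr>)"
    unfolding totally_def
  proof (rule ballI, rule subsetI)
    fix \<tau> y assume \<tau>: "\<tau> \<in> Homs ?M" and "y \<in> \<tau> ` carrier (F\<lparr>carrier := ?M\<rparr>)"
    then obtain x where x: "x \<in> ?M" "y = \<tau> x" by auto
    obtain \<phi> where "\<phi> \<in> Homs (carrier F)" "restrict \<phi> ?M = \<tau>"
      using extend_Homs[OF M carrier_in_subexts subextsD(3)[OF M] \<tau>] by blast
    thus "y \<in> K" using x by (metis (no_types, lifting) mem_Collect_eq restrict_apply')
  qed
  have "max_totally L E K \<iota> F = ?M"
    unfolding max_totally_def
  proof (rule Greatest_equality)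
    show "?M \<in> subexts F (\<iota> ` E) \<and> totally L E K \<iota> (F\<lparr>carrier := ?M\<rparr>)" using M tot by blast
    fix N assume N: "N \<in> subexts F (\<iota> ` E) \<and> totally L E K \<iota> (F\<lparr>carrier := N\<rparr>)"
    hence Ns: "N \<in> subexts F (\<iota> ` E)" by blast
    show "N \<le> ?M"
    proof
      fix x assume x: "x \<in> N"
      have "\<phi> x \<in> K" if \<phi>: "\<phi> \<in> Homs (carrier F)" for \<phi>
      proof -
        have "restrict \<phi> N \<in> Homs N" by (rule restrict_Homs[OF Ns subextsD(3)[OF Ns] \<phi>])
        hence "restrict \<phi> N ` carrier (F\<lparr>carrier := N\<rparr>) \<subseteq> K" using N unfolding totally_def by blast
        thus ?thesis using x by auto
      qed
      thus "x \<in> ?M" using x subextsD(3)[OF Ns] by auto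
    qed
  qed
  thus "max_totally L E K \<iota> F = ?M" "max_totally L E K \<iota> F \<in> subexts F (\<iota> ` E)"
    "totally L E K \<iota> (F\<lparr>carrier := max_totally L E K \<iota> F\<rparr>)"
    using M tot by simp_all
qed

text \<open>For each of the finitely many pairs of distinct members of \<open>A\<close>, an element
  of \<open>M\<close> where they differ is adjoined to the base field.\<close>

lemma finite_subextension_separating:
  assumes M: "M \<in> subexts F (\<iota> ` E)" and A: "finite A" "A \<subseteq> Homs M"
  obtains N where "N \<in> fin_subexts F (\<iota> ` E)" "N \<subseteq> M" "inj_on (\<lambda>\<phi>. restrict \<phi> N) A"
proof -
  define d where "d = (\<lambda>(\<phi> :: 'b \<Rightarrow> 'a, \<psi>). SOME x. x \<in> M \<and> \<phi> x \<noteq> \<psi> x)"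
  define D where "D = {(\<phi>, \<psi>) \<in> A \<times> A. \<phi> \<noteq> \<psi>}"
  have d: "d (\<phi>, \<psi>) \<in> M \<and> \<phi> (d (\<phi>, \<psi>)) \<noteq> \<psi> (d (\<phi>, \<psi>))" if "(\<phi>, \<psi>) \<in> D" for \<phi> \<psi>
  proof -
    have "\<phi> \<in> Homs M" "\<psi> \<in> Homs M" "\<phi> \<noteq> \<psi>" using that A(2) by (auto simp: D_def)
    hence "\<exists>x. x \<in> M \<and> \<phi> x \<noteq> \<psi> x" using HomsD(2) extensionalityI by metis
    thus ?thesis unfolding d_def by (simp, rule someI_ex)
  qed
  have "finite D" using A(1) by (auto simp: D_def intro: finite_subset[of _ "A \<times> A"])
  then obtain xs where xs: "set xs = d ` D" using finite_list[of "d ` D"] by blast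
  have xsM: "set xs \<subseteq> M" using d xs by auto
  hence xsF: "set xs \<subseteq> carrier F" using subextsD(3)[OF M] by blast
  have alg: "(F.algebraic over (\<iota> ` E)) x" if "x \<in> set xs" for x
    using algebraic_over_base xsF that by (auto simp: over_def)
  define N where "N = F.finite_extension (\<iota> ` E) xs"
  have "N \<in> fin_subexts F (\<iota> ` E)"
    using F.finite_extension_is_subfield[OF base_subfield xsF alg]
      F.finite_extension_finite_dimension(1)[OF base_subfield xsF alg]
      F.finite_extension_incl[OF subfieldE(3)[OF base_subfield] xsF]
    by (simp only: fin_subexts_def subexts_def N_def mem_Collect_eq)
  moreover have "N \<subseteq> M"
    unfolding N_def by (rule F.finite_extension_subring_incl[OF subextsD(5,2)[OF M] xsM])
  moreover have "inj_on (\<lambda>\<phi>. restrict \<phi> N) A"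
  proof (rule inj_onI, rule ccontr)
    fix \<phi> \<psi> assume "\<phi> \<in> A" "\<psi> \<in> A" "\<phi> \<noteq> \<psi>" and eq: "restrict \<phi> N = restrict \<psi> N"
    hence D: "(\<phi>, \<psi>) \<in> D" by (simp add: D_def)
    have "set xs \<subseteq> N" unfolding N_def
      by (rule F.finite_extension_mem[OF subfieldE(1)[OF base_subfield] xsF])
    hence "d (\<phi>, \<psi>) \<in> N" using D xs by blast
    thus False using fun_cong[OF eq, of "d (\<phi>, \<psi>)"] d[OF D] by simp
  qed
  ultimately show thesis using that by blast
qed

end

theorem theoremA1:
  fixes L :: "('a, 'm) ring_scheme" and E K :: "'a set"
    and F :: "('b, 'n) ring_scheme" and \<iota> :: "'a \<Rightarrow> 'b"
  assumes "algebraic_closure L E"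
    and "subfield K L" and "E \<subseteq> K"
    and "field F" and "\<iota> \<in> ring_hom (L\<lparr>carrier := E\<rparr>) F"
    and "\<And>x. x \<in> carrier F \<Longrightarrow> ring.algebraic F (\<iota> ` E) x"
    and "\<exists>p::nat. Factorial_Ring.prime p \<and> \<not> dvd_sep_degree p L E \<iota> F \<and>
           pro_p_group p (aut_group L K) (krull_topology L K)"
  shows "ennreal_of_enat (sep_degree L E \<iota> (F\<lparr>carrier := max_totally L E K \<iota> F\<rparr>))
    \<le> dir_liminf (fin_subexts F (\<iota> ` E))
        (\<lambda>F\<^sub>0. ennreal_of_enat
          (ecard (ext_homs E \<iota> (F\<lparr>carrier := F\<^sub>0\<rparr>) (L\<lparr>carrier := ins_closure L K\<rparr>))))"
proof -
  obtain p :: nat where p: "Factorial_Ring.prime p" "\<not> dvd_sep_degree p L E \<iota> F"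
    "pro_p_group p (aut_group L K) (krull_topology L K)"
    using assms(7) by blast
  interpret algebraic_ext L E F \<iota>
    using assms(1,4-6) by (simp add: algebraic_ext_def algebraic_ext_axioms_def)
  let ?M = "max_totally L E K \<iota> F"
  let ?H = "\<lambda>N. ext_homs E \<iota> (F\<lparr>carrier := N\<rparr>) (L\<lparr>carrier := ins_closure L K\<rparr>)"
  note M = max_totally_eq(2,3)[OF assms(2,3)]
  show ?thesis unfolding sep_degree_def
  proof (rule ennreal_of_enat_ecard_le)
    fix A assume A: "finite A" "A \<subseteq> Homs ?M"
    obtain M\<^sub>0 where M\<^sub>0: "M\<^sub>0 \<in> fin_subexts F (\<iota> ` E)" "M\<^sub>0 \<subseteq> ?M" "inj_on (\<lambda>\<phi>. restrict \<phi> M\<^sub>0) A"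
      using finite_subextension_separating[OF M(1) A] by blast
    have sub: "M\<^sub>0 \<in> subexts F (\<iota> ` E)" using M\<^sub>0(1) by (simp add: fin_subexts_def)
    have "card A \<le> card (Homs M\<^sub>0)"
      by (rule card_inj_on_le[OF M\<^sub>0(3) _ finite_Homs[OF M\<^sub>0(1)]])
        (use restrict_Homs[OF sub M\<^sub>0(2)] A(2) in blast)
    \<comment> \<open>A homomorphism from \<open>M\<^sub>0\<close> inherits its image in
      \<open>K\<close> from an extension to the totally-\<open>K\<close> field
      \<open>?M\<close>.\<close>
    have tot: "\<tau> ` M\<^sub>0 \<subseteq> K" if \<tau>: "\<tau> \<in> Homs M\<^sub>0" for \<tau>
    proof -
      obtain \<phi> where \<phi>: "\<phi> \<in> Homs ?M" "restrict \<phi> M\<^sub>0 = \<tau>"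
        using extend_Homs[OF sub M(1) M\<^sub>0(2) \<tau>] by blast
      have "\<phi> ` ?M \<subseteq> K" using M(2) \<phi>(1) by (auto simp: totally_def)
      moreover have "\<tau> ` M\<^sub>0 = \<phi> ` M\<^sub>0" unfolding \<phi>(2)[symmetric] by simp
      ultimately show ?thesis using M\<^sub>0(2) by blast
    qed
    show "of_nat (card A) \<le> dir_liminf (fin_subexts F (\<iota> ` E)) (\<lambda>N. ennreal_of_enat (ecard (?H N)))"
    proof (rule le_dir_liminfI[OF M\<^sub>0(1)])
      fix N assume N: "N \<in> fin_subexts F (\<iota> ` E)" "M\<^sub>0 \<subseteq> N"
      \<comment> \<open>\<open>Homs N\<close> is finite, so the separable degree of \<open>N\<close>
        is an actual number, and the hypothesis on \<open>p\<close> applies to it.\<close>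
      have nd: "\<not> p dvd card (Homs N)"
        using p(2) N(1) finite_Homs[OF N(1)] by (auto simp: dvd_sep_degree_def sep_degree_def ecard_def)
      note le = card_Homs_le_card_ins_closure_homs[OF assms(2,3) p(1,3) M\<^sub>0(1) N nd tot]
      have "card A \<le> card (?H N)" using \<open>card A \<le> card (Homs M\<^sub>0)\<close> le(2) by linarith
      thus "of_nat (card A) \<le> ennreal_of_enat (ecard (?H N))" using le(1) by (simp add: ecard_def)
    qed
  qed
qed

end
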